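(* Let $\alpha>-1/2$, $n\in\mathbb{Z}_0^+$, assume $f\in C^{n+1}[-1,1]$ with $\|f^{(n+1)}\|_{L^\infty[-1,1]}\le A$ for a constant $A>0$ independent of $n$, and let $\int_{-1}^{x_{n,j}^{(\alpha)}}f(x)\,dx$ be approximated by the barycentric Gegenbauer quadrature $\sum_{i=0}^n p_{B,j,i}^{(1)}f(x_{n,i}^{(\alpha)})$ for each GG node $x_{n,j}^{(\alpha)}$, $j=0,\dots,n$, with truncation error $E_n^{(\alpha)}(x_{n,j}^{(\alpha)},\zeta_{n,j}^{(\alpha)})$. Then there exist positive constants $D_1^{(\alpha)},D_2^{(\alpha)}$ independent of $n$ such that: (i) if $\alpha\ge0$: $|E_n^{(\alpha)}|\le \dfrac{A\,2^{-n}(x_{n,j}^{(\alpha)}+1)\,\Gamma(\alpha+1)\,\Gamma(n+2\alpha+1)}{\Gamma(2\alpha+1)\,\Gamma(n+2)\,\Gamma(n+\alpha+1)}$; (ii) if $\frac{n+1}{2}\in\mathbb{Z}^+$ and $-\frac12<\alpha<0$: $|E_n^{(\alpha)}|\le \dfrac{A\,2^{-n-1}(x_{n,j}^{(\alpha)}+1)\,\Gamma(\alpha)}{\Gamma(n+\alpha+1)}\dbinom{\frac{n-1}{2}+\alpha}{\frac{n+1}{2}}$; (iii) if $\frac n2\in\mathbb{Z}_0^+$ and $-\frac12<\alpha<0$: $|E_n^{(\alpha)}|< \dfrac{A\,2^{-n}(x_{n,j}^{(\alpha)}+1)\,\Gamma(\alpha+1)}{\sqrt{(n+1)(2\alpha+n+1)}\,\Gamma(n+\alpha+1)}\dbinom{\frac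 n2+\alpha}{\frac n2}$. Moreover, as $n\to\infty$, asymptotically $|E_n^{(\alpha)}|\lesssim B_1^{(\alpha)}(e/2)^n(x_{n,j}^{(\alpha)}+1)\,n^{\alpha-n-3/2}$ if $\alpha\ge0$, and $|E_n^{(\alpha)}|\lesssim B_2^{(\alpha)}(e/2)^n(x_{n,j}^{(\alpha)}+1)\,n^{-n-3/2}$ if $-\frac12<\alpha<0$, for all $j=0,\dots,n$, where $B_1^{(\alpha)}=AD_1^{(\alpha)}$ and $B_2^{(\alpha)}=B_1^{(\alpha)}D_2^{(\alpha)}$.
   Context: For $\alpha>-1/2$ and integer $n\ge0$, the Gegenbauer polynomial $G_n^{(\alpha)}$ is the Jacobi polynomial $P_n^{(\alpha-1/2,\alpha-1/2)}$ normalized so that $G_n^{(\alpha)}(1)=1$; $K_n^{(\alpha)}$ is its leading coefficient. GG nodes $x_{n,0}^{(\alpha)},\dots,x_{n,n}^{(\alpha)}$ are the zeros of $G_{n+1}^{(\alpha)}$. The barycentric GIM entries are $p_{B,j,i}^{(1)}=\int_{-1}^{x_{n,j}^{(\alpha)}}\mathcal{L}_{B,n,i}^{(\alpha)}(x)\,dx$, where $\mathcal{L}_{B,n,i}^{(\alpha)}$ is the degree-$n$ Lagrange basis polynomial at the GG nodes. The truncation error is $E_n^{(\alpha)}(x_{n,j}^{(\alpha)},\zeta_{n,j}^{(\alpha)})=\frac{f^{(n+1)}(\zeta_{n,j}^{(\alpha)})}{(n+1)!\,K_{n+1}^{(\alpha)}}\int_{-1}^{x_{n,j}^{(\alpha)}}G_{n+1}^{(\alpha)}(x)\,dx$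 for some $\zeta_{n,j}^{(\alpha)}\in[-1,1]$. Binomial coefficients with non-integer upper argument are $\binom{a}{b}=\Gamma(a+1)/(\Gamma(b+1)\Gamma(a-b+1))$. The symbol $\lesssim$ denotes an asymptotic inequality as $n\to\infty$. *)

theory Defs
  imports "HOL-Analysis.Analysis" "HOL-Computational_Algebra.Polynomial" "HOL-Library.Landau_Symbols"
begin

text \<open>Jacobi polynomial P_n^(a,b) via its standard hypergeometric representation
  P_n^(a,b)(x) = (a+1)_n / n! * 2F1(-n, n+a+b+1; a+1; (1-x)/2).\<close>
definition jacobi_poly :: "nat \<Rightarrow> real \<Rightarrow> real \<Rightarrow> real poly" where
  "jacobi_poly n a b =
     (\<Sum>k\<le>n. smult (pochhammer (a + 1) n / fact n *
                     (pochhammer (- real n) k * pochhammer (real n + a + b + 1) k /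
                      (pochhammer (a + 1) k * fact k)))
                 ([:1/2, -1/2:] ^ k))"

definition gegenbauer_poly :: "real \<Rightarrow> nat \<Rightarrow> real poly" where
  "gegenbauer_poly \<alpha> n =
     smult (1 / poly (jacobi_poly n (\<alpha> - 1/2) (\<alpha> - 1/2)) 1) (jacobi_poly n (\<alpha> - 1/2) (\<alpha> - 1/2))"

definition gegenbauer :: "real \<Rightarrow> nat \<Rightarrow> real \<Rightarrow> real" where
  "gegenbauer \<alpha> n x = poly (gegenbauer_poly \<alpha> n) x"

definition gegenbauer_K :: "real \<Rightarrow> nat \<Rightarrow> real" where
  "gegenbauer_K \<alpha> n = lead_coeff (gegenbauer_poly \<alpha> n)"

definition gg_node :: "real \<Rightarrow> nat \<Rightarrow> nat \<Rightarrow> real" where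
  "gg_node \<alpha> n j = sorted_list_of_set {x. poly (gegenbauer_poly \<alpha> (Suc n)) x = 0} ! j"

definition lagrange_basis :: "real \<Rightarrow> nat \<Rightarrow> nat \<Rightarrow> real \<Rightarrow> real" where
  "lagrange_basis \<alpha> n i x =
     (\<Prod>k\<in>{0..n} - {i}. (x - gg_node \<alpha> n k) / (gg_node \<alpha> n i - gg_node \<alpha> n k))"

definition gim_entry :: "real \<Rightarrow> nat \<Rightarrow> nat \<Rightarrow> nat \<Rightarrow> real" where
  "gim_entry \<alpha> n j i = integral {-1..gg_node \<alpha> n j} (lagrange_basis \<alpha> n i)"

definition quad_error :: "real \<Rightarrow> nat \<Rightarrow> (real \<Rightarrow> real) \<Rightarrow> nat \<Rightarrow> real" where
  "quad_error \<alpha> n f j =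
     integral {-1..gg_node \<alpha> n j} f - (\<Sum>i\<le>n. gim_entry \<alpha> n j i * f (gg_node \<alpha> n i))"

text \<open>Truncation error formula E_n^(alpha)(x, zeta), with d = f^(n+1)(zeta).\<close>
definition trunc_error :: "real \<Rightarrow> nat \<Rightarrow> real \<Rightarrow> real \<Rightarrow> real" where
  "trunc_error \<alpha> n d x =
     d / (fact (Suc n) * gegenbauer_K \<alpha> (Suc n)) * integral {-1..x} (gegenbauer \<alpha> (Suc n))"

definition gbinom :: "real \<Rightarrow> real \<Rightarrow> real" where
  "gbinom a b = Gamma (a + 1) / (Gamma (b + 1) * Gamma (a - b + 1))"

definition gg_hyps :: "real \<Rightarrow> nat \<Rightarrow> real \<Rightarrow> (nat \<Rightarrow> real \<Rightarrow> real) \<Rightarrow> (nat \<Rightarrow> real) \<Rightarrow> bool" where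
  "gg_hyps \<alpha> n A Df \<zeta> \<longleftrightarrow>
     A > 0 \<and>
     (\<forall>k\<le>n. \<forall>x\<in>{-1..1}. (Df k has_real_derivative Df (Suc k) x) (at x within {-1..1})) \<and>
     continuous_on {-1..1} (Df (Suc n)) \<and>
     (\<forall>x\<in>{-1..1}. \<bar>Df (Suc n) x\<bar> \<le> A) \<and>
     (\<forall>j\<le>n. \<zeta> j \<in> {-1..1} \<and>
        quad_error \<alpha> n (Df 0) j = trunc_error \<alpha> n (Df (Suc n) (\<zeta> j)) (gg_node \<alpha> n j))"

end

theory Submission
  imports Defs "HOL-Real_Asymp.Real_Asymp"
begin

text \<open>
  Write \<open>y\<close> for the normalized Gegenbauer polynomial of degree \<open>m = n + 1\<close> and \<open>c = m * (m + 2 * \<alpha>)\<close>.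
  It satisfies \<open>(1 - x\<^sup>2) y'' - (2\<alpha> + 1) x y' + c y = 0\<close>, so Sonin's function
  \<open>y\<^sup>2 + (1 - x\<^sup>2) y'\<^sup>2 / c\<close> has derivative \<open>4 \<alpha> x y'\<^sup>2 / c\<close>. Hence on \<open>[-1, 1]\<close> it is largest at the endpoints,
  where it is 1, if \<open>\<alpha> \<ge> 0\<close>, and at the origin if \<open>\<alpha> < 0\<close>. In the second case its value is the
  square of the constant coefficient (\<open>m\<close> even), or the square of the linear coefficient divided by \<open>c\<close>
  (\<open>m\<close> odd), and the coefficient recurrence of the differential equation compares these with the
  leading coefficient. The bound is strict for odd \<open>m\<close> because \<open>y\<close> vanishes at the node.

  The nodes lie in \<open>(-1, 1)\<close>: since \<open>y'\<close> is a multiple of the Gegenbauer polynomial with parameters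
  \<open>\<alpha> + 1\<close> and \<open>m - 1\<close>, and the derivative of \<open>(1 - x\<^sup>2) powr (\<alpha> + 1/2) * y'\<close> is
  \<open>- c * (1 - x\<^sup>2) powr (\<alpha> - 1/2) * y\<close>, Rolle's theorem gives one more zero at each degree.
\<close>

section \<open>The differential equation and the coefficients\<close>

text \<open>The power series coefficients of the Gauss function 2F1(-m, m + 2\<alpha>; \<alpha> +
  1/2; t), where t = (1 - x) / 2.\<close>

definition gegenbauer_hyp_coeff :: "real \<Rightarrow> nat \<Rightarrow> nat \<Rightarrow> real" where
  "gegenbauer_hyp_coeff \<alpha> m k =
     pochhammer (- real m) k * pochhammer (real m + 2 * \<alpha>) k / (pochhammer (\<alpha> + 1/2) k * fact k)"

definition gegenbauer_hyp :: "real \<Rightarrow> nat \<Rightarrow> real poly" where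
  "gegenbauer_hyp \<alpha> m = (\<Sum>k\<le>m. monom (gegenbauer_hyp_coeff \<alpha> m k) k)"

text \<open>Since \<open>pochhammer (- real m) k\<close> vanishes for \<open>k > m\<close>, the
  series truncates by itself, and coefficient comparisons need no range condition on
  \<open>k\<close>.\<close>

lemma coeff_gegenbauer_hyp: "coeff (gegenbauer_hyp \<alpha> m) k = gegenbauer_hyp_coeff \<alpha> m k"
proof (cases "k \<le> m")
  case True
  then show ?thesis
    by (simp add: gegenbauer_hyp_def coeff_sum)
next
  case False
  then show ?thesis
    by (simp add: gegenbauer_hyp_def coeff_sum gegenbauer_hyp_coeff_def pochhammer_of_nat_eq_0_iff)
qed

lemma gegenbauer_hyp_coeff_0: "gegenbauer_hyp_coeff \<alpha> m 0 = 1"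
  by (simp add: gegenbauer_hyp_coeff_def)

lemma gegenbauer_hyp_coeff_Suc:
  assumes "\<alpha> > -1/2"
  shows "(real k + \<alpha> + 1/2) * (real k + 1) * gegenbauer_hyp_coeff \<alpha> m (Suc k) =
         (real k - real m) * (real k + real m + 2 * \<alpha>) * gegenbauer_hyp_coeff \<alpha> m k"
proof -
  have "pochhammer (\<alpha> + 1/2) k > 0"
    using assms by (intro pochhammer_pos) simp
  moreover have "real k + \<alpha> + 1/2 > 0" "\<alpha> + 1/2 + real k > 0"
    using assms by simp_all
  ultimately show ?thesis
    by (simp add: gegenbauer_hyp_coeff_def pochhammer_Suc divide_simps) (simp add: algebra_simps)
qed

text \<open>At x = 1 the variable t = (1 - x) / 2 is 0 and the series equals 1, so the Jacobi
  prefactor \<open>pochhammer (\<alpha> + 1/2) m / fact m\<close> is the Jacobi value there and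
  cancels in the normalization.\<close>

lemma gegenbauer_poly_eq_pcompose:
  assumes "\<alpha> > -1/2"
  shows "gegenbauer_poly \<alpha> m = pcompose (gegenbauer_hyp \<alpha> m) [:1/2, -1/2:]"
proof -
  define c where "c = pochhammer (\<alpha> + 1/2) m / fact m"
  have "c > 0"
    unfolding c_def using assms by (intro divide_pos_pos pochhammer_pos) simp_all
  have J: "jacobi_poly m (\<alpha> - 1/2) (\<alpha> - 1/2) =
      smult c (pcompose (gegenbauer_hyp \<alpha> m) [:1/2, -1/2:])"
    unfolding poly_eq_poly_eq_iff[symmetric]
    by (rule ext) (simp add: jacobi_poly_def gegenbauer_hyp_def gegenbauer_hyp_coeff_def c_def
        poly_sum poly_pcompose poly_monom sum_distrib_left algebra_simps)
  have "poly (pcompose (gegenbauer_hyp \<alpha> m) [:1/2, -1/2:]) 1 = 1"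
    by (simp add: poly_pcompose poly_0_coeff_0 coeff_gegenbauer_hyp gegenbauer_hyp_coeff_0)
  then show ?thesis
    using \<open>c > 0\<close> by (simp add: gegenbauer_poly_def J)
qed

lemma poly_gegenbauer_1:
  assumes "\<alpha> > -1/2"
  shows "poly (gegenbauer_poly \<alpha> m) 1 = 1"
  using assms by (simp add: gegenbauer_poly_eq_pcompose poly_pcompose poly_0_coeff_0
      coeff_gegenbauer_hyp gegenbauer_hyp_coeff_0)

text \<open>Gauss's hypergeometric equation: its coefficient at t^k is the recurrence between
  consecutive series coefficients.\<close>

lemma gegenbauer_hyp_ode:
  assumes "\<alpha> > -1/2"
  shows "[:0, 1, -1:] * pderiv (pderiv (gegenbauer_hyp \<alpha> m)) +
         smult (\<alpha> + 1/2) ([:1, -2:] * pderiv (gegenbauer_hyp \<alpha> m)) +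
         smult (real m * (real m + 2 * \<alpha>)) (gegenbauer_hyp \<alpha> m) = 0"
    (is "?p = 0")
proof (rule poly_eqI)
  fix k
  \<comment> \<open>Multiplication by a quadratic shifts indices by up to two, so
    \<open>k = 0\<close>, \<open>k = 1\<close> and larger \<open>k\<close> are treated
    separately.\<close>
  have *: "coeff ?p k = (real k + \<alpha> + 1/2) * (real k + 1) * gegenbauer_hyp_coeff \<alpha> m (Suc k)
     - (real k - real m) * (real k + real m + 2 * \<alpha>) * gegenbauer_hyp_coeff \<alpha> m k"
    by (cases k; cases "k - 1")
       (auto simp: coeff_pCons coeff_pderiv coeff_gegenbauer_hyp field_simps)
  show "coeff ?p k = coeff 0 k"
    unfolding * using gegenbauer_hyp_coeff_Suc[OF assms, of k m] by simp
qed

text \<open>The substitution t = (1 - x) / 2 in Gauss's equation: each derivative in x brings a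
  factor -1/2, and 1 - x^2 = 4 t (1 - t).\<close>

lemma gegenbauer_ode:
  assumes "\<alpha> > -1/2"
  shows "(1 - x\<^sup>2) * poly (pderiv (pderiv (gegenbauer_poly \<alpha> m))) x
         - (2 * \<alpha> + 1) * x * poly (pderiv (gegenbauer_poly \<alpha> m)) x
         + real m * (real m + 2 * \<alpha>) * poly (gegenbauer_poly \<alpha> m) x = 0"
proof -
  define F where "F = gegenbauer_hyp \<alpha> m"
  define t where "t = (1 - x) / 2"
  have G: "gegenbauer_poly \<alpha> m = pcompose F [:1/2, -1/2:]"
    using gegenbauer_poly_eq_pcompose[OF assms] by (simp add: F_def)
  have x: "x = 1 - 2 * t"
    by (simp add: t_def field_simps)
  have "poly ([:0, 1, -1:] * pderiv (pderiv F) + smult (\<alpha> + 1/2) ([:1, -2:] * pderiv F) +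
         smult (real m * (real m + 2 * \<alpha>)) F) t = 0"
    unfolding F_def gegenbauer_hyp_ode[OF assms] by simp
  then have ode: "t * (1 - t) * poly (pderiv (pderiv F)) t + (\<alpha> + 1/2) * (1 - 2 * t) * poly (pderiv F) t
       + real m * (real m + 2 * \<alpha>) * poly F t = 0"
    by (simp add: algebra_simps)
  have "pderiv [:1/2, -1/2:] = [:-1/2::real:]"
    by (simp add: pderiv_pCons)
  then have 1: "pderiv (pcompose F [:1/2, -1/2:]) = smult (-1/2) (pcompose (pderiv F) [:1/2, -1/2:])"
   and 2: "pderiv (pcompose (pderiv F) [:1/2, -1/2:]) =
     smult (-1/2) (pcompose (pderiv (pderiv F)) [:1/2, -1/2:])"
    by (simp_all add: pderiv_pcompose)
  have "poly [:1/2, -1/2:] x = t"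
    by (simp add: t_def field_simps)
  then have vals: "poly (gegenbauer_poly \<alpha> m) x = poly F t"
    "poly (pderiv (gegenbauer_poly \<alpha> m)) x = - poly (pderiv F) t / 2"
    "poly (pderiv (pderiv (gegenbauer_poly \<alpha> m))) x = poly (pderiv (pderiv F)) t / 4"
    unfolding G 1 2 by (simp_all only: pderiv_smult 2 poly_smult poly_pcompose)
  have sq: "1 - x\<^sup>2 = 4 * (t * (1 - t))"
    by (simp add: x power2_eq_square algebra_simps)
  show ?thesis
    unfolding vals sq using ode by (simp add: x field_simps)
qed

text \<open>Differentiating a 2F1 raises all three parameters by one. From (-m - 1, m + 1 +
  2\<alpha>; \<alpha> + 1/2) this gives the parameters that belong to \<open>\<alpha> + 1\<close>
  and \<open>m\<close>. Thus critical points at degree \<open>Suc m\<close> are zeros at degree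
  \<open>m\<close>.\<close>

lemma pderiv_gegenbauer_poly:
  assumes "\<alpha> > -1/2"
  shows "pderiv (gegenbauer_poly \<alpha> (Suc m)) =
    smult ((real m + 1) * (real m + 1 + 2 * \<alpha>) / (2 * \<alpha> + 1)) (gegenbauer_poly (\<alpha> + 1) m)"
proof -
  define c where "c = (real m + 1) * (real m + 1 + 2 * \<alpha>) / (2 * \<alpha> + 1)"
  have "pderiv (gegenbauer_hyp \<alpha> (Suc m)) = smult (-2 * c) (gegenbauer_hyp (\<alpha> + 1) m)"
  proof (rule poly_eqI)
    fix k
    have "pochhammer (\<alpha> + 1 + 1/2) k > 0" "\<alpha> + 1/2 > 0"
      using assms by (auto intro!: pochhammer_pos)
    then show "coeff (pderiv (gegenbauer_hyp \<alpha> (Suc m))) k = coeff (smult (-2 * c) (gegenbauer_hyp (\<alpha> + 1) m)) k"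
      by (simp add: coeff_pderiv coeff_gegenbauer_hyp gegenbauer_hyp_coeff_def pochhammer_rec
          c_def divide_simps add_ac distrib_left) (simp add: algebra_simps)
  qed
  moreover have "pderiv [:1/2, -1/2:] = [:-1/2::real:]"
    by (simp add: pderiv_pCons)
  ultimately show ?thesis
    using assms
    by (simp add: gegenbauer_poly_eq_pcompose pderiv_pcompose pcompose_smult pcompose_uminus flip: c_def)
qed

lemma degree_lead_coeff_gegenbauer:
  assumes "\<alpha> > -1/2"
  shows "degree (gegenbauer_poly \<alpha> m) = m"
    and "gegenbauer_K \<alpha> m = pochhammer (real m + 2 * \<alpha>) m / (pochhammer (\<alpha> + 1/2) m * 2 ^ m)"
    and "gegenbauer_K \<alpha> m > 0"
proof -
  have p1: "pochhammer (\<alpha> + 1/2) m > 0"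
    using assms by (intro pochhammer_pos) simp
  \<comment> \<open>For \<open>m = 0\<close> the base 2\<alpha> may be negative, but the product is
    empty; for \<open>m \<ge> 1\<close> the base is positive.\<close>
  have p2: "pochhammer (real m + 2 * \<alpha>) m > 0"
    using assms by (cases m) (auto intro!: pochhammer_pos)
  have c: "gegenbauer_hyp_coeff \<alpha> m m =
      (-1) ^ m * pochhammer (real m + 2 * \<alpha>) m / pochhammer (\<alpha> + 1/2) m"
    by (simp add: gegenbauer_hyp_coeff_def pochhammer_same)
  have "degree (gegenbauer_hyp \<alpha> m) = m"
  proof (rule antisym)
    show "degree (gegenbauer_hyp \<alpha> m) \<le> m"
      by (rule degree_le) (simp add: coeff_gegenbauer_hyp gegenbauer_hyp_coeff_def
          pochhammer_of_nat_eq_0_iff)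
    show "m \<le> degree (gegenbauer_hyp \<alpha> m)"
      using p1 p2 by (intro le_degree) (simp add: coeff_gegenbauer_hyp c)
  qed
  moreover have "lead_coeff (pcompose (gegenbauer_hyp \<alpha> m) [:1/2, -1/2:]) =
      lead_coeff (gegenbauer_hyp \<alpha> m) * lead_coeff [:1/2, -1/2:] ^ degree (gegenbauer_hyp \<alpha> m)"
    by (rule lead_coeff_comp) simp
  ultimately show "degree (gegenbauer_poly \<alpha> m) = m"
    and K: "gegenbauer_K \<alpha> m = pochhammer (real m + 2 * \<alpha>) m / (pochhammer (\<alpha> + 1/2) m * 2 ^ m)"
    using assms
    by (simp_all add: gegenbauer_K_def gegenbauer_poly_eq_pcompose degree_pcompose
        coeff_gegenbauer_hyp c power_divide power_minus[of "1/2::real"])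
  show "gegenbauer_K \<alpha> m > 0"
    unfolding K using p1 p2 by simp
qed

section \<open>Coefficients in powers of x, and parity\<close>

lemma coeff_gegenbauer_poly_rec:
  assumes "\<alpha> > -1/2"
  shows "(real j + 2) * (real j + 1) * coeff (gegenbauer_poly \<alpha> m) (j + 2) =
    (real j - real m) * (real j + real m + 2 * \<alpha>) * coeff (gegenbauer_poly \<alpha> m) j"
proof -
  define G where "G = gegenbauer_poly \<alpha> m"
  define p where "p = [:1, 0, -1:] * pderiv (pderiv G) - smult (2 * \<alpha> + 1) ([:0, 1:] * pderiv G)
     + smult (real m * (real m + 2 * \<alpha>)) G"
  have "poly p = poly 0"
  proof
    fix x
    show "poly p x = poly 0 x"
      using gegenbauer_ode[OF assms, of x m]
      by (simp add: p_def G_def power2_eq_square algebra_simps)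
  qed
  then have "coeff p j = 0"
    by (simp add: poly_eq_poly_eq_iff)
  moreover have "coeff p j = (real j + 2) * (real j + 1) * coeff G (j + 2)
      - (real j - real m) * (real j + real m + 2 * \<alpha>) * coeff G j"
    by (cases j; cases "j - 1")
       (auto simp: p_def coeff_pCons coeff_pderiv algebra_simps)
  ultimately show ?thesis
    by (simp add: G_def)
qed

text \<open>Descending in steps of two from the index \<open>m + 1\<close>, which exceeds the
  degree, the recurrence forces each coefficient to vanish, because its factor (j - m)(j + m +
  2\<alpha>) is nonzero for \<open>j < m\<close>.\<close>

lemma coeff_gegenbauer_poly_eq_0:
  assumes "\<alpha> > -1/2" and "odd (m + j)"
  shows "coeff (gegenbauer_poly \<alpha> m) j = 0"
proof (cases "j \<le> m")
  case True
  have "coeff (gegenbauer_poly \<alpha> m) j = 0" if "m + 1 = j + 2 * i" "j \<le> m" for i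
    using that
  proof (induction i arbitrary: j)
    case 0
    then show ?case by simp
  next
    case (Suc i)
    have "coeff (gegenbauer_poly \<alpha> m) (j + 2) = 0"
    proof (cases "j + 2 \<le> m")
      case True
      then show ?thesis using Suc by (intro Suc.IH) simp_all
    next
      case False
      then show ?thesis
        by (intro coeff_eq_0) (simp add: degree_lead_coeff_gegenbauer[OF assms(1)])
    qed
    moreover have "j < m"
      using Suc.prems by presburger
    moreover from this have "real j + real m + 2 * \<alpha> > 0"
      using assms(1) by linarith
    ultimately show ?case
      using coeff_gegenbauer_poly_rec[OF assms(1), of j m] by auto
  qed
  moreover have "m + 1 = j + 2 * ((m + 1 - j) div 2)"
    using True assms(2) by presburger
  ultimately show ?thesis
    using True by blast
next
  case False
  then show ?thesis
    by (intro coeff_eq_0) (simp add: degree_lead_coeff_gegenbauer[OF assms(1)])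
qed

lemma poly_gegenbauer_minus:
  assumes "\<alpha> > -1/2"
  shows "poly (gegenbauer_poly \<alpha> m) (- x) = (-1) ^ m * poly (gegenbauer_poly \<alpha> m) x"
proof -
  have "coeff (gegenbauer_poly \<alpha> m) i * (- x) ^ i = (-1) ^ m * (coeff (gegenbauer_poly \<alpha> m) i * x ^ i)" for i
  proof (cases "odd (m + i)")
    case True
    then show ?thesis by (simp add: coeff_gegenbauer_poly_eq_0[OF assms])
  next
    case False
    then have "(-1 :: real) ^ i = (-1) ^ m"
      by (cases "even m") auto
    then show ?thesis by (simp add: power_minus[of x])
  qed
  then show ?thesis
    by (simp only: poly_altdef sum_distrib_left)
qed

text \<open>Descending from the leading coefficient with the recurrence avoids evaluating the
  hypergeometric sum at the origin.\<close>

lemma coeff_gegenbauer_poly_lead: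
  assumes "\<alpha> > -1/2" and "m = j + 2 * i"
  shows "\<bar>coeff (gegenbauer_poly \<alpha> m) j\<bar> * (4 ^ i * fact i * pochhammer (real (j + i) + \<alpha>) i) * fact j =
         gegenbauer_K \<alpha> m * fact m"
  using assms(2)
proof (induction i arbitrary: j)
  case 0
  then show ?case
    using degree_lead_coeff_gegenbauer(1,3)[OF assms(1), of m] by (simp add: gegenbauer_K_def)
next
  case (Suc i)
  define c where "c = (\<lambda>j. \<bar>coeff (gegenbauer_poly \<alpha> m) j\<bar>)"
  have m: "real m = real j + 2 * (real i + 1)"
    using Suc.prems by simp
  have pos: "real j + real i + 1 + \<alpha> > 0"
    using assms(1) by linarith
  have "\<bar>(real j + 2) * (real j + 1) * coeff (gegenbauer_poly \<alpha> m) (j + 2)\<bar> =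
    \<bar>(real j - real m) * (real j + real m + 2 * \<alpha>) * coeff (gegenbauer_poly \<alpha> m) j\<bar>"
    using coeff_gegenbauer_poly_rec[OF assms(1), of j m] by simp
  moreover have "real j - real m = - (2 * (real i + 1))"
    "real j + real m + 2 * \<alpha> = 2 * (real j + real i + 1 + \<alpha>)"
    by (simp_all add: m)
  ultimately have rec: "(real j + 2) * (real j + 1) * c (j + 2) =
      4 * (real i + 1) * (real j + real i + 1 + \<alpha>) * c j"
    using pos by (simp add: abs_mult c_def) (simp add: algebra_simps)
  have IH: "c (j + 2) * (4 ^ i * fact i * pochhammer (real (j + 2 + i) + \<alpha>) i) * fact (j + 2) =
         gegenbauer_K \<alpha> m * fact m"
    unfolding c_def using Suc.prems by (intro Suc.IH) simp
  have f: "fact (j + 2) = (real j + 2) * (real j + 1) * fact j"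
    by (simp add: algebra_simps)
  \<comment> \<open>Splitting off the first factor leaves the symbol of the induction hypothesis at
    \<open>j + 2\<close>, since (j + i + 1) + 1 = (j + 2) + i.\<close>
  have "pochhammer (real (j + Suc i) + \<alpha>) (Suc i) =
      (real j + real i + 1 + \<alpha>) * pochhammer (real (j + 2 + i) + \<alpha>) i"
    by (simp add: pochhammer_rec add_ac)
  then have "c j * (4 ^ Suc i * fact (Suc i) * pochhammer (real (j + Suc i) + \<alpha>) (Suc i)) * fact j =
     (4 * (real i + 1) * (real j + real i + 1 + \<alpha>) * c j) *
     (4 ^ i * fact i * pochhammer (real (j + 2 + i) + \<alpha>) i) * fact j"
    by (simp add: algebra_simps)
  also have "\<dots> = c (j + 2) * (4 ^ i * fact i * pochhammer (real (j + 2 + i) + \<alpha>) i) * fact (j + 2)"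
    unfolding rec[symmetric] f by (simp only: mult_ac)
  also note IH
  finally show ?case
    unfolding c_def .
qed

section \<open>Zeros\<close>

text \<open>Rolle's theorem between neighbours in the sorted list; the open gaps are disjoint, so
  the points found are distinct. Differentiability is asked only inside the interval because the
  weight used below can be singular at the endpoints.\<close>

lemma Rolle_finite_set:
  fixes f f' :: "real \<Rightarrow> real"
  assumes fin: "finite S" and card: "card S = Suc k" and sub: "S \<subseteq> {a..b}"
    and cont: "continuous_on {a..b} f"
    and deriv: "\<And>x. a < x \<Longrightarrow> x < b \<Longrightarrow> (f has_real_derivative f' x) (at x)"
    and zero: "\<And>x. x \<in> S \<Longrightarrow> f x = 0"
  shows "\<exists>T. finite T \<and> card T = k \<and> T \<subseteq> {a<..<b} \<and> (\<forall>x\<in>T. f' x = 0)"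
proof -
  define xs where "xs = sorted_list_of_set S"
  have len: "length xs = Suc k" and set: "set xs = S" and srt: "sorted_wrt (<) xs"
    using fin card by (simp_all add: xs_def)
  have mono: "xs ! i < xs ! j" if "i < j" "j \<le> k" for i j
    using sorted_wrt_nth_less[OF srt] that len by simp
  have mem: "xs ! i \<in> S" if "i \<le> k" for i
    using that len set nth_mem[of i xs] by simp
  have "\<exists>z. xs ! i < z \<and> z < xs ! Suc i \<and> f' z = 0" if "i < k" for i
  proof -
    have i: "a \<le> xs ! i" "xs ! Suc i \<le> b"
      using mem[of i] mem[of "Suc i"] that sub by auto
    have "\<exists>z. xs ! i < z \<and> z < xs ! Suc i \<and> (\<lambda>v. f' z * v) = (\<lambda>v. 0)"
    proof (rule Rolle_deriv)
      show "xs ! i < xs ! Suc i" using that mono by simp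
      show "f (xs ! i) = f (xs ! Suc i)" using mem that by (simp add: zero)
      show "continuous_on {xs ! i..xs ! Suc i} f"
        by (rule continuous_on_subset[OF cont]) (use i in auto)
      show "(f has_derivative (\<lambda>v. f' x * v)) (at x)" if "xs ! i < x" "x < xs ! Suc i" for x
        using deriv[of x] that i by (simp add: has_field_derivative_def)
    qed
    then obtain z where z: "xs ! i < z" "z < xs ! Suc i" "(\<lambda>v. f' z * v) = (\<lambda>v. 0)"
      by blast
    \<comment> \<open>Rolle's theorem says that the derivative is the zero linear map; evaluation at
      1 extracts its slope.\<close>
    from fun_cong[OF z(3), of 1] have "f' z = 0"
      by simp
    with z show ?thesis by blast
  qed
  then obtain z where z: "\<And>i. i < k \<Longrightarrow> xs ! i < z i \<and> z i < xs ! Suc i \<and> f' (z i) = 0"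
    by metis
  have less: "z i < z j" if "i < j" "j < k" for i j
  proof -
    have "z i < xs ! Suc i" using z that by simp
    also have "\<dots> \<le> xs ! j"
      using mono[of "Suc i" j] that by (cases "Suc i = j") auto
    also have "\<dots> < z j" using z that by simp
    finally show ?thesis .
  qed
  have "inj_on z {..<k}"
    by (rule linorder_inj_onI') (use less in force)
  then have "card (z ` {..<k}) = k"
    by (simp add: card_image)
  moreover have "z i \<in> {a<..<b}" if "i < k" for i
    using z[OF that] mem[of i] mem[of "Suc i"] that sub by fastforce
  ultimately show ?thesis
    using z by (intro exI[of _ "z ` {..<k}"]) auto
qed

lemma gegenbauer_zeros_exist:
  assumes "\<alpha> > -1/2"
  shows "\<exists>T. finite T \<and> card T = m \<and> T \<subseteq> {-1<..<1} \<and> (\<forall>x\<in>T. poly (gegenbauer_poly \<alpha> m) x = 0)"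
  using assms
proof (induction m arbitrary: \<alpha>)
  case 0
  then show ?case by (intro exI[of _ "{}"]) simp
next
  case (Suc m)
  define G where "G = gegenbauer_poly \<alpha> (Suc m)"
  define c where "c = real (Suc m) * (real (Suc m) + 2 * \<alpha>)"
  have "c > 0"
    using Suc.prems by (simp add: c_def)
  from Suc.IH[of "\<alpha> + 1"] Suc.prems obtain T where T: "finite T" "card T = m" "T \<subseteq> {-1<..<1}"
    "\<And>x. x \<in> T \<Longrightarrow> poly (gegenbauer_poly (\<alpha> + 1) m) x = 0"
    by auto
  have "\<exists>T'. finite T' \<and> card T' = Suc m \<and> T' \<subseteq> {-1<..<1} \<and>
      (\<forall>x\<in>T'. - c * (1 - x\<^sup>2) powr (\<alpha> - 1/2) * poly G x = 0)"
  proof (rule Rolle_finite_set)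
    let ?f = "\<lambda>x. (1 - x\<^sup>2) powr (\<alpha> + 1/2) * poly (pderiv G) x"
    \<comment> \<open>The weight vanishes at both endpoints as \<alpha> + 1/2 > 0, and on
      \<open>T\<close> the derivative of \<open>G\<close> does. These are m + 2 points, one more
      than the number of zeros wanted.\<close>
    let ?S = "insert (-1) (insert 1 T)"
    show "finite ?S" "?S \<subseteq> {-1..1}" using T by auto
    show "card ?S = Suc (Suc m)"
      using T by (subst card_insert_disjoint card_insert_disjoint, force, force)+ simp
    show "?f x = 0" if "x \<in> ?S" for x
      using that T(4) Suc.prems by (auto simp: G_def pderiv_gegenbauer_poly)
    show "continuous_on {-1..1} ?f"
      using Suc.prems
      by (intro continuous_intros continuous_on_powr') (auto simp: power2_le_iff_abs_le abs_le_iff abs_square_le_1)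
    show "(?f has_real_derivative - c * (1 - x\<^sup>2) powr (\<alpha> - 1/2) * poly G x) (at x)"
      if "-1 < x" "x < 1" for x
    proof -
      have pos: "1 - x\<^sup>2 > 0"
        using that by (simp add: abs_square_less_1 abs_less_iff)
      have "(1 - x\<^sup>2) powr (\<alpha> + 1/2) = (1 - x\<^sup>2) powr (\<alpha> - 1/2) * (1 - x\<^sup>2)"
        using pos powr_add[of "1 - x\<^sup>2" "\<alpha> - 1/2" 1] by (simp add: algebra_simps)
      \<comment> \<open>This is the differential equation in self-adjoint form: its right-hand side
        times (1 - x^2) powr (\<alpha> - 1/2) is the derivative of \<open>?f\<close>.\<close>
      moreover have eq: "- c * poly G x =
          (1 - x\<^sup>2) * poly (pderiv (pderiv G)) x - (2 * \<alpha> + 1) * x * poly (pderiv G) x"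
        using gegenbauer_ode[OF Suc.prems, of x "Suc m"] by (simp add: G_def c_def)
      have "- c * (1 - x\<^sup>2) powr (\<alpha> - 1/2) * poly G x = (1 - x\<^sup>2) powr (\<alpha> - 1/2) *
          ((1 - x\<^sup>2) * poly (pderiv (pderiv G)) x - (2 * \<alpha> + 1) * x * poly (pderiv G) x)"
        unfolding eq[symmetric] by simp
      moreover have "(?f has_real_derivative
          (\<alpha> + 1/2) * (1 - x\<^sup>2) powr (\<alpha> - 1/2) * (- (2 * x)) * poly (pderiv G) x
          + (1 - x\<^sup>2) powr (\<alpha> + 1/2) * poly (pderiv (pderiv G)) x) (at x)"
      proof -
        have "((\<lambda>x. 1 - x\<^sup>2) has_real_derivative - (2 * x)) (at x)"
          by (auto intro!: derivative_eq_intros)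
        from DERIV_fun_powr[OF this pos, of "\<alpha> + 1/2"]
        have "((\<lambda>x. (1 - x\<^sup>2) powr (\<alpha> + 1/2)) has_real_derivative
            (\<alpha> + 1/2) * (1 - x\<^sup>2) powr (\<alpha> - 1/2) * (- (2 * x))) (at x)"
          by simp
        from DERIV_mult[OF this poly_DERIV[of "pderiv G" x]] show ?thesis
          by (simp add: mult_ac)
      qed
      moreover have "(\<alpha> + 1/2) * (1 - x\<^sup>2) powr (\<alpha> - 1/2) * (- (2 * x)) * poly (pderiv G) x
          + (1 - x\<^sup>2) powr (\<alpha> - 1/2) * (1 - x\<^sup>2) * poly (pderiv (pderiv G)) x =
          (1 - x\<^sup>2) powr (\<alpha> - 1/2) *
          ((1 - x\<^sup>2) * poly (pderiv (pderiv G)) x - (2 * \<alpha> + 1) * x * poly (pderiv G) x)"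
        by (simp add: algebra_simps)
      ultimately show ?thesis
        by simp
    qed
  qed
  then obtain T' where T': "finite T'" "card T' = Suc m" "T' \<subseteq> {-1<..<1}"
     "\<And>x. x \<in> T' \<Longrightarrow> - c * (1 - x\<^sup>2) powr (\<alpha> - 1/2) * poly G x = 0"
    by auto
  have "poly G x = 0" if "x \<in> T'" for x
  proof -
    have "1 - x\<^sup>2 > 0"
      using that T'(3) by (auto simp: abs_square_less_1 abs_less_iff)
    then show ?thesis
      using T'(4)[OF that] \<open>c > 0\<close> by auto
  qed
  with T' show ?case
    by (intro exI[of _ T']) (simp add: G_def)
qed

text \<open>The n + 1 zeros already found in the open interval exhaust the zeros of a polynomial of
  degree n + 1. So the sorted list has length n + 1, and the index \<open>j \<le> n\<close> is in
  range.\<close>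

lemma gg_node_zero:
  assumes "\<alpha> > -1/2" and "j \<le> n"
  shows "gg_node \<alpha> n j \<in> {-1<..<1}" and "poly (gegenbauer_poly \<alpha> (Suc n)) (gg_node \<alpha> n j) = 0"
proof -
  define G where "G = gegenbauer_poly \<alpha> (Suc n)"
  define Z where "Z = {x. poly G x = 0}"
  have "degree G = Suc n"
    using assms(1) by (simp add: G_def degree_lead_coeff_gegenbauer)
  then have "G \<noteq> 0" by auto
  then have Z: "finite Z" "card Z \<le> Suc n"
    using poly_roots_finite[of G] card_poly_roots_bound[of G] \<open>degree G = Suc n\<close>
    by (simp_all add: Z_def)
  obtain T where T: "card T = Suc n" "T \<subseteq> {-1<..<1}" "\<forall>x\<in>T. poly G x = 0"
    using gegenbauer_zeros_exist[OF assms(1), of "Suc n"] by (auto simp: G_def)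
  have "T = Z"
    by (rule card_seteq) (use T Z in \<open>auto simp: Z_def\<close>)
  have "gg_node \<alpha> n j = sorted_list_of_set Z ! j"
    by (simp add: gg_node_def Z_def G_def)
  moreover have "sorted_list_of_set Z ! j \<in> set (sorted_list_of_set Z)"
    using T(1) \<open>T = Z\<close> assms(2) by (intro nth_mem) simp
  ultimately have "gg_node \<alpha> n j \<in> Z"
    using Z by simp
  then show "gg_node \<alpha> n j \<in> {-1<..<1}" "poly (gegenbauer_poly \<alpha> (Suc n)) (gg_node \<alpha> n j) = 0"
    using T(2) \<open>T = Z\<close> by (auto simp: Z_def G_def)
qed

section \<open>Maximum norm\<close>

definition sonin :: "real \<Rightarrow> nat \<Rightarrow> real \<Rightarrow> real" where
  "sonin \<alpha> m x = (poly (gegenbauer_poly \<alpha> m) x)\<^sup>2 +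
     (1 - x\<^sup>2) / (real m * (real m + 2 * \<alpha>)) * (poly (pderiv (gegenbauer_poly \<alpha> m)) x)\<^sup>2"

text \<open>Replacing (1 - x^2) y'' by means of the differential equation cancels the terms in y y';
  the coefficient 2 (2\<alpha> + 1) - 2 = 4\<alpha> of x y'^2 / c remains.\<close>

lemma has_real_derivative_sonin:
  assumes "\<alpha> > -1/2" and "m > 0"
  shows "(sonin \<alpha> m has_real_derivative
     4 * \<alpha> * x * (poly (pderiv (gegenbauer_poly \<alpha> m)) x)\<^sup>2 / (real m * (real m + 2 * \<alpha>))) (at x)"
proof -
  define y y1 y2 where "y = poly (gegenbauer_poly \<alpha> m) x"
    and "y1 = poly (pderiv (gegenbauer_poly \<alpha> m)) x"
    and "y2 = poly (pderiv (pderiv (gegenbauer_poly \<alpha> m))) x"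
  define c where "c = real m * (real m + 2 * \<alpha>)"
  have "real m \<ge> 1" using assms(2) by simp
  then have "real m + 2 * \<alpha> > 0"
    using assms(1) by linarith
  then have "c > 0"
    using assms by (simp add: c_def)
  have ode: "(1 - x\<^sup>2) * y2 = (2 * \<alpha> + 1) * x * y1 - c * y"
    using gegenbauer_ode[OF assms(1), of x m] by (simp add: y_def y1_def y2_def c_def)
  have "2 * y * y1 + (- 2 * x / c * y1\<^sup>2 + 2 * ((1 - x\<^sup>2) * y2) / c * y1) = 4 * \<alpha> * x * y1\<^sup>2 / c"
    unfolding ode using \<open>c > 0\<close> by (simp add: field_simps power2_eq_square)
  moreover have "(sonin \<alpha> m has_real_derivative
      2 * y * y1 + (- 2 * x / c * y1\<^sup>2 + 2 * ((1 - x\<^sup>2) * y2) / c * y1)) (at x)"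
    unfolding sonin_def y_def y1_def y2_def c_def[symmetric]
    using \<open>c > 0\<close> by (auto intro!: derivative_eq_intros simp: power2_eq_square field_simps)
  ultimately show ?thesis
    by (simp add: y1_def c_def)
qed

lemma square_gegenbauer_le_sonin:
  assumes "\<alpha> > -1/2" and "\<bar>x\<bar> \<le> 1"
  shows "(poly (gegenbauer_poly \<alpha> m) x)\<^sup>2 \<le> sonin \<alpha> m x"
proof -
  \<comment> \<open>For \<open>m = 0\<close> this product is 0, and division by it yields 0, so
    Sonin's function is then the square itself.\<close>
  have "real m * (real m + 2 * \<alpha>) \<ge> 0"
    using assms by (cases m) auto
  moreover have "x\<^sup>2 \<le> 1"
    using assms(2) by (simp add: abs_square_le_1)
  ultimately show ?thesis
    by (simp add: sonin_def)
qed

text \<open>Parity reduces the estimates to [0, 1], where the derivative of Sonin's function has a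
  constant sign, determined by that of \<alpha>.\<close>

lemma square_gegenbauer_abs:
  assumes "\<alpha> > -1/2"
  shows "(poly (gegenbauer_poly \<alpha> m) \<bar>x\<bar>)\<^sup>2 = (poly (gegenbauer_poly \<alpha> m) x)\<^sup>2"
  using poly_gegenbauer_minus[OF assms, of m x]
  by (simp add: abs_if power_mult_distrib flip: power_mult)

lemma abs_gegenbauer_le_1:
  assumes "\<alpha> \<ge> 0" and "m > 0" and "\<bar>x\<bar> \<le> 1"
  shows "\<bar>poly (gegenbauer_poly \<alpha> m) x\<bar> \<le> 1"
proof -
  have \<alpha>: "\<alpha> > -1/2" using assms by simp
  have "(poly (gegenbauer_poly \<alpha> m) \<bar>x\<bar>)\<^sup>2 \<le> sonin \<alpha> m \<bar>x\<bar>"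
    using assms by (intro square_gegenbauer_le_sonin) auto
  also have "\<dots> \<le> sonin \<alpha> m 1"
  proof (rule DERIV_nonneg_imp_nondecreasing[where f = "sonin \<alpha> m"])
    show "\<bar>x\<bar> \<le> 1" by fact
    show "\<exists>y. (sonin \<alpha> m has_real_derivative y) (at t) \<and> 0 \<le> y" if "\<bar>x\<bar> \<le> t" "t \<le> 1" for t
    proof -
      have "t \<ge> 0" using that by simp
      then show ?thesis
        using assms(1) has_real_derivative_sonin[OF \<alpha> \<open>m > 0\<close>, of t]
        by (meson divide_nonneg_nonneg mult_nonneg_nonneg zero_le_power2 of_nat_0_le_iff
            add_nonneg_nonneg zero_le_numeral)
    qed
  qed
  also have "\<dots> = 1"
    by (simp add: sonin_def poly_gegenbauer_1[OF \<alpha>])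
  finally show ?thesis
    by (simp add: square_gegenbauer_abs[OF \<alpha>] abs_square_le_1)
qed

lemma square_gegenbauer_le_sonin_0:
  assumes "\<alpha> > -1/2" and "\<alpha> < 0" and "m > 0" and "\<bar>x\<bar> \<le> 1"
  shows "(poly (gegenbauer_poly \<alpha> m) x)\<^sup>2 \<le> sonin \<alpha> m 0"
proof -
  have "real m \<ge> 1" using assms(3) by simp
  then have pos: "real m + 2 * \<alpha> > 0"
    using assms(1) by linarith
  have "(poly (gegenbauer_poly \<alpha> m) \<bar>x\<bar>)\<^sup>2 \<le> sonin \<alpha> m \<bar>x\<bar>"
    using assms by (intro square_gegenbauer_le_sonin) auto
  also have "\<dots> \<le> sonin \<alpha> m 0"
  proof (rule DERIV_nonpos_imp_nonincreasing[where f = "sonin \<alpha> m"])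
    show "\<exists>y. (sonin \<alpha> m has_real_derivative y) (at t) \<and> y \<le> 0" if "0 \<le> t" "t \<le> \<bar>x\<bar>" for t
    proof -
      have "4 * \<alpha> * t * (poly (pderiv (gegenbauer_poly \<alpha> m)) t)\<^sup>2 / (real m * (real m + 2 * \<alpha>)) \<le> 0"
        using assms(2,3) that(1) pos mult_nonpos_nonneg[of \<alpha> t]
        by (intro divide_nonpos_pos mult_nonpos_nonneg[of "4 * \<alpha> * t"] mult_pos_pos) auto
      then show ?thesis
        using has_real_derivative_sonin[OF assms(1,3), of t] by blast
    qed
  qed simp
  finally show ?thesis
    by (simp add: square_gegenbauer_abs[OF assms(1)])
qed

lemma abs_gegenbauer_le_even:
  assumes "\<alpha> > -1/2" and "\<alpha> < 0" and "m > 0" and "even m" and "\<bar>x\<bar> \<le> 1"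
  shows "\<bar>poly (gegenbauer_poly \<alpha> m) x\<bar> \<le> \<bar>coeff (gegenbauer_poly \<alpha> m) 0\<bar>"
proof -
  have "coeff (gegenbauer_poly \<alpha> m) 1 = 0"
    using assms by (intro coeff_gegenbauer_poly_eq_0) auto
  then have "sonin \<alpha> m 0 = (coeff (gegenbauer_poly \<alpha> m) 0)\<^sup>2"
    by (simp add: sonin_def poly_0_coeff_0 coeff_pderiv)
  then show ?thesis
    using square_gegenbauer_le_sonin_0[OF assms(1-3,5)] by (simp add: abs_le_square_iff)
qed

lemma abs_gegenbauer_le_odd:
  assumes "\<alpha> > -1/2" and "\<alpha> < 0" and "odd m" and "\<bar>x\<bar> \<le> 1"
  shows "\<bar>poly (gegenbauer_poly \<alpha> m) x\<bar> \<le>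
    \<bar>coeff (gegenbauer_poly \<alpha> m) 1\<bar> / sqrt (real m * (real m + 2 * \<alpha>))"
proof -
  have "m > 0" using assms(3) by (cases m) auto
  have "real m \<ge> 1" using \<open>m > 0\<close> by simp
  then have pos: "real m + 2 * \<alpha> > 0"
    using assms(1) by linarith
  have "coeff (gegenbauer_poly \<alpha> m) 0 = 0"
    using assms by (intro coeff_gegenbauer_poly_eq_0) auto
  then have "sonin \<alpha> m 0 =
      (\<bar>coeff (gegenbauer_poly \<alpha> m) 1\<bar> / sqrt (real m * (real m + 2 * \<alpha>)))\<^sup>2"
    using pos by (simp add: sonin_def poly_0_coeff_0 coeff_pderiv power_divide)
  then have "(poly (gegenbauer_poly \<alpha> m) x)\<^sup>2 \<le>
      (\<bar>coeff (gegenbauer_poly \<alpha> m) 1\<bar> / sqrt (real m * (real m + 2 * \<alpha>)))\<^sup>2"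
    using square_gegenbauer_le_sonin_0[OF assms(1,2) \<open>m > 0\<close> assms(4)] by simp
  then show ?thesis
    using pos by (simp add: abs_le_square_iff[symmetric])
qed

section \<open>Bounds for the truncation error\<close>

lemma abs_trunc_error_le:
  assumes "\<alpha> > -1/2" and "\<bar>d\<bar> \<le> A" and "-1 \<le> x" and "x \<le> 1"
    and bound: "\<And>t. \<bar>t\<bar> \<le> 1 \<Longrightarrow> \<bar>poly (gegenbauer_poly \<alpha> (Suc n)) t\<bar> \<le> M"
  shows "\<bar>trunc_error \<alpha> n d x\<bar> \<le> A * (M / (gegenbauer_K \<alpha> (Suc n) * fact (Suc n))) * (x + 1)"
proof -
  let ?K = "gegenbauer_K \<alpha> (Suc n)" and ?I = "integral {-1..x} (gegenbauer \<alpha> (Suc n))"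
  have K: "?K > 0"
    using assms(1) by (rule degree_lead_coeff_gegenbauer)
  have "norm ?I \<le> integral {-1..x} (\<lambda>t. M)"
    by (rule integral_norm_bound_integral)
       (use assms in \<open>auto simp: gegenbauer_def[abs_def] intro!: integrable_continuous_real continuous_intros\<close>)
  then have "\<bar>?I\<bar> \<le> M * (x + 1)"
    using assms(3) by (simp add: mult.commute)
  then have "\<bar>d\<bar> / (fact (Suc n) * ?K) * \<bar>?I\<bar> \<le> A / (fact (Suc n) * ?K) * (M * (x + 1))"
    using K assms(2) by (intro mult_mono divide_right_mono) auto
  moreover have "\<bar>trunc_error \<alpha> n d x\<bar> = \<bar>d\<bar> / (fact (Suc n) * ?K) * \<bar>?I\<bar>"
    using K by (simp add: trunc_error_def abs_mult)
  ultimately show ?thesis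
    by (simp add: mult_ac)
qed

lemma abs_trunc_error_less:
  assumes "\<alpha> > -1/2" and "\<bar>d\<bar> \<le> A" and "A > 0" and "-1 < x" and "x \<le> 1"
    and bound: "\<And>t. \<bar>t\<bar> \<le> 1 \<Longrightarrow> \<bar>poly (gegenbauer_poly \<alpha> (Suc n)) t\<bar> \<le> M"
    and zero: "poly (gegenbauer_poly \<alpha> (Suc n)) x = 0" and "M > 0"
  shows "\<bar>trunc_error \<alpha> n d x\<bar> < A * (M / (gegenbauer_K \<alpha> (Suc n) * fact (Suc n))) * (x + 1)"
proof -
  let ?G = "gegenbauer \<alpha> (Suc n)"
  let ?K = "gegenbauer_K \<alpha> (Suc n)" and ?I = "integral {-1..x} ?G"
  have K: "?K > 0"
    using assms(1) by (rule degree_lead_coeff_gegenbauer)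
  have cont: "continuous_on {-1..x} ?G"
    by (auto simp: gegenbauer_def[abs_def] intro!: continuous_intros)
  then have int: "?G integrable_on {-1..x}" "(\<lambda>t. \<bar>?G t\<bar>) integrable_on {-1..x}"
    by (auto intro!: integrable_continuous_real continuous_intros)
  have le: "\<bar>?G t\<bar> \<le> M" if "t \<in> {-1..x}" for t
    using that assms(5) by (auto simp: gegenbauer_def intro!: bound)
  \<comment> \<open>A continuous nonnegative function with integral zero vanishes identically, but
    this one equals \<open>M > 0\<close> at the zero \<open>x\<close>.\<close>
  have "integral {-1..x} (\<lambda>t. M - \<bar>?G t\<bar>) \<noteq> 0"
  proof
    assume "integral {-1..x} (\<lambda>t. M - \<bar>?G t\<bar>) = 0"
    then have "\<forall>t\<in>{-1..x}. M - \<bar>?G t\<bar> = 0"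
      using cont le \<open>-1 < x\<close> by (subst (asm) integral_eq_0_iff) (auto intro!: continuous_intros)
    then have "M - \<bar>?G x\<bar> = 0"
      using \<open>-1 < x\<close> by auto
    then show False
      using zero \<open>M > 0\<close> by (simp add: gegenbauer_def)
  qed
  moreover have "integral {-1..x} (\<lambda>t. M - \<bar>?G t\<bar>) \<ge> 0"
    using le int by (intro integral_nonneg integrable_diff) auto
  moreover have "integral {-1..x} (\<lambda>t. M - \<bar>?G t\<bar>) = M * (x + 1) - integral {-1..x} (\<lambda>t. \<bar>?G t\<bar>)"
    using int \<open>-1 < x\<close> by (subst integral_diff) auto
  moreover have "\<bar>?I\<bar> \<le> integral {-1..x} (\<lambda>t. \<bar>?G t\<bar>)"
    using integral_norm_bound_integral[OF int] by simp
  ultimately have I: "\<bar>?I\<bar> < M * (x + 1)"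
    by linarith
  have "\<bar>trunc_error \<alpha> n d x\<bar> = \<bar>d\<bar> / (fact (Suc n) * ?K) * \<bar>?I\<bar>"
    using K by (simp add: trunc_error_def abs_mult)
  also have "\<dots> \<le> A / (fact (Suc n) * ?K) * \<bar>?I\<bar>"
    using K assms(2) by (intro mult_right_mono divide_right_mono) auto
  \<comment> \<open>Strictness enters only after \<open>\<bar>d\<bar>\<close>, which may be 0, has
    been replaced by the positive \<open>A\<close>.\<close>
  also have "\<dots> < A / (fact (Suc n) * ?K) * (M * (x + 1))"
    using K I \<open>A > 0\<close> by (intro mult_strict_left_mono) auto
  finally show ?thesis
    by (simp add: mult_ac)
qed

text \<open>The bounds of Sonin's method for the maximum norm of the polynomial of degree \<open>n + 1\<close>,
  divided by its leading coefficient and by \<open>(n + 1)!\<close>. Rounding up in \<open>(n + 1) div 2\<close> makes the two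
  parities agree up to the last factor.\<close>

definition error_factor_nonneg :: "real \<Rightarrow> nat \<Rightarrow> real" where
  "error_factor_nonneg \<alpha> n = Gamma (\<alpha> + 1) * Gamma (real n + 2 * \<alpha> + 1) /
     (2 ^ n * Gamma (2 * \<alpha> + 1) * fact (Suc n) * Gamma (real n + \<alpha> + 1))"

definition error_factor_neg :: "real \<Rightarrow> nat \<Rightarrow> real" where
  "error_factor_neg \<alpha> n =
     Gamma (real ((n + 1) div 2) + \<alpha> + 1) /
       (2 ^ n * fact ((n + 1) div 2) * Gamma (real n + \<alpha> + 1)) *
     (if even n then 1 / sqrt ((real n + 1) * (2 * \<alpha> + real n + 1)) else 1 / (real n + 1 + 2 * \<alpha>))"

section \<open>Closed forms of the error factors through the Gamma function\<close>

lemma gegenbauer_K_eq_Gamma: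
  assumes "\<alpha> > -1/2"
  shows "1 / (gegenbauer_K \<alpha> (Suc n) * fact (Suc n)) = error_factor_nonneg \<alpha> n"
proof -
  define m where "m = Suc n"
  have nn: "x \<notin> \<int>\<^sub>\<le>\<^sub>0" if "x > 0" for x :: real
    using that by auto
  have m: "real m = real n + 1" by (simp add: m_def)
  have pos: "Gamma (\<alpha> + 1) > 0" "Gamma (2 * \<alpha> + 1) > 0" "Gamma (real m + \<alpha>) > 0"
    "Gamma (real m + 2 * \<alpha>) > 0" "pochhammer (\<alpha> + 1/2) m > 0" "real m + \<alpha> > 0" "real m + 2 * \<alpha> > 0"
    using assms by (auto simp: m intro!: Gamma_real_pos pochhammer_pos)
  \<comment> \<open>Legendre duplication in Pochhammer form expresses Gamma (2m + 2\<alpha>), the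
    numerator of the Pochhammer symbol in the leading coefficient, through
    \<open>pochhammer (\<alpha> + 1/2) m\<close>, which then cancels. The base is 2\<alpha> + 1
    rather than 2\<alpha> because the latter may be zero or negative.\<close>
  have "Gamma (2 * \<alpha> + 1 + real (2 * m)) / Gamma (2 * \<alpha> + 1) = pochhammer (2 * (\<alpha> + 1/2)) (2 * m)"
    using assms by (subst pochhammer_Gamma) (auto intro!: nn simp: algebra_simps)
  also have "\<dots> = 4 ^ m * pochhammer (\<alpha> + 1/2) m * pochhammer (\<alpha> + 1) m"
    by (subst pochhammer_double) (simp add: power_mult add_ac)
  also have "pochhammer (\<alpha> + 1) m = Gamma (real m + \<alpha> + 1) / Gamma (\<alpha> + 1)"
    using assms by (subst pochhammer_Gamma) (auto intro!: nn simp: add_ac)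
  also have "Gamma (real m + \<alpha> + 1) = (real m + \<alpha>) * Gamma (real m + \<alpha>)"
    using pos by (intro Gamma_plus1 nn)
  also have "2 * \<alpha> + 1 + real (2 * m) = (2 * (real m + \<alpha>)) + 1"
    by simp
  also have "Gamma \<dots> = 2 * (real m + \<alpha>) * Gamma (2 * (real m + \<alpha>))"
    using pos by (intro Gamma_plus1 nn) simp
  finally have eq: "2 * (real m + \<alpha>) * Gamma (2 * (real m + \<alpha>)) / Gamma (2 * \<alpha> + 1) =
      4 ^ m * pochhammer (\<alpha> + 1/2) m * ((real m + \<alpha>) * Gamma (real m + \<alpha>) / Gamma (\<alpha> + 1))" .
  have "X = 4 ^ m * p * Z * Y / (2 * W)"
    if "2 * s * X / Y = 4 ^ m * p * (s * Z / W)" "s > 0" "Y > 0" "W > 0" for s X Y p Z W :: real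
    using that by (simp add: field_simps)
  from this[OF eq] have "Gamma (2 * (real m + \<alpha>)) =
      4 ^ m * pochhammer (\<alpha> + 1/2) m * Gamma (real m + \<alpha>) * Gamma (2 * \<alpha> + 1) / (2 * Gamma (\<alpha> + 1))"
    using pos by blast
  \<comment> \<open>Writing 4^m as 2^m * (2 * 2^n) prepares the cancellation of the 2^m in the
    leading coefficient.\<close>
  then have X: "Gamma (2 * (real m + \<alpha>)) = 2 ^ m * (2 * 2 ^ n) *
      pochhammer (\<alpha> + 1/2) m * Gamma (real m + \<alpha>) * Gamma (2 * \<alpha> + 1) / (2 * Gamma (\<alpha> + 1))"
    by (simp add: m_def power_mult_distrib[symmetric])
  have p: "pochhammer (real m + 2 * \<alpha>) m = Gamma (2 * (real m + \<alpha>)) / Gamma (real m + 2 * \<alpha>)"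
    using pos by (subst pochhammer_Gamma) (auto intro!: nn simp: algebra_simps)
  have "gegenbauer_K \<alpha> m =
     2 ^ n * Gamma (real m + \<alpha>) * Gamma (2 * \<alpha> + 1) / (Gamma (\<alpha> + 1) * Gamma (real m + 2 * \<alpha>))"
    using pos(5) unfolding degree_lead_coeff_gegenbauer(2)[OF assms] p X by (simp add: mult_ac)
  then show ?thesis
    using pos by (simp add: error_factor_nonneg_def m_def[symmetric] m add_ac mult_ac)
qed

text \<open>The descent from the leading coefficient of the even degree n + 1 = 2k takes k steps to
  reach the constant term.\<close>

lemma coeff_0_gegenbauer_eq_Gamma:
  assumes "\<alpha> > -1/2" and "odd n"
  shows "\<bar>coeff (gegenbauer_poly \<alpha> (Suc n)) 0\<bar> / (gegenbauer_K \<alpha> (Suc n) * fact (Suc n)) =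
    error_factor_neg \<alpha> n"
proof -
  define k where "k = (n + 1) div 2"
  have n: "Suc n = 2 * k" and "k \<ge> 1"
    using assms(2) by (auto simp: k_def elim!: oddE)
  have rn: "real n = 2 * real k - 1"
    using n by linarith
  have nn: "x \<notin> \<int>\<^sub>\<le>\<^sub>0" if "x > 0" for x :: real
    using that by auto
  have k\<alpha>: "real k + \<alpha> > 0"
    using \<open>k \<ge> 1\<close> assms(1) by linarith
  have pos: "Gamma (real k + \<alpha>) > 0" "Gamma (2 * real k + \<alpha>) > 0" "gegenbauer_K \<alpha> (Suc n) > 0"
    using k\<alpha> degree_lead_coeff_gegenbauer(3)[OF assms(1)] by (auto intro!: Gamma_real_pos)
  have p0: "pochhammer (real k + \<alpha>) k \<noteq> 0"
    using pochhammer_pos[OF k\<alpha>, of k] by simp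
  have p: "pochhammer (real k + \<alpha>) k = Gamma (2 * real k + \<alpha>) / Gamma (real k + \<alpha>)"
    using k\<alpha> by (subst pochhammer_Gamma) (auto intro!: nn simp: algebra_simps)
  have "\<bar>coeff (gegenbauer_poly \<alpha> (Suc n)) 0\<bar> * (4 ^ k * fact k * pochhammer (real k + \<alpha>) k) =
         gegenbauer_K \<alpha> (Suc n) * fact (Suc n)"
    using coeff_gegenbauer_poly_lead[OF assms(1), of "Suc n" 0 k] n by simp
  then have "\<bar>coeff (gegenbauer_poly \<alpha> (Suc n)) 0\<bar> / (gegenbauer_K \<alpha> (Suc n) * fact (Suc n)) =
      1 / (4 ^ k * fact k * pochhammer (real k + \<alpha>) k)"
    using pos by (simp add: divide_simps p0 del: fact_Suc)
  also have "(4::real) ^ k = 2 ^ Suc n"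
    unfolding n by (simp add: power_mult)
  \<comment> \<open>Expanding by k + \<alpha> turns Gamma (k + \<alpha>) into Gamma (k + \<alpha> +
    1), the form shared with even \<open>n\<close>; the leftover 2 (k + \<alpha>) is n + 1 +
    2\<alpha>.\<close>
  also have "1 / (2 ^ Suc n * fact k * pochhammer (real k + \<alpha>) k) =
      (real k + \<alpha>) * Gamma (real k + \<alpha>) / (2 ^ n * fact k * Gamma (2 * real k + \<alpha>)) * (1 / (2 * (real k + \<alpha>)))"
  proof -
    have "1 / (2 ^ Suc n * fact k * (b / a)) = s * a / (2 ^ n * fact k * b) * (1 / (2 * s))"
      if "a > 0" "b > 0" "s > 0" for a b s :: real
      using that by (simp add: field_simps)
    from this[OF pos(1,2) k\<alpha>] show ?thesis unfolding p .
  qed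
  also have "(real k + \<alpha>) * Gamma (real k + \<alpha>) = Gamma (real k + \<alpha> + 1)"
    using k\<alpha> by (intro Gamma_plus1[symmetric] nn)
  finally show ?thesis
    using assms(2) unfolding error_factor_neg_def k_def[symmetric]
    by (simp add: rn algebra_simps)
qed

text \<open>For n = 2k the degree is 2k + 1, and k descents reach the linear term; rounding in
  \<open>(n + 1) div 2\<close> gives this same k.\<close>

lemma coeff_1_gegenbauer_eq_Gamma:
  assumes "\<alpha> > -1/2" and "even n"
  shows "\<bar>coeff (gegenbauer_poly \<alpha> (Suc n)) 1\<bar> / sqrt (real (Suc n) * (real (Suc n) + 2 * \<alpha>)) /
      (gegenbauer_K \<alpha> (Suc n) * fact (Suc n)) = error_factor_neg \<alpha> n"
proof -
  define k where "k = (n + 1) div 2"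
  have n: "n = 2 * k"
    using assms(2) by (auto simp: k_def elim!: evenE)
  have nn: "x \<notin> \<int>\<^sub>\<le>\<^sub>0" if "x > 0" for x :: real
    using that by auto
  have pos: "Gamma (real k + \<alpha> + 1) > 0" "Gamma (2 * real k + \<alpha> + 1) > 0" "gegenbauer_K \<alpha> (Suc n) > 0"
    using assms(1) degree_lead_coeff_gegenbauer(3)[OF assms(1)] by (auto intro!: Gamma_real_pos)
  have p0: "pochhammer (real k + \<alpha> + 1) k \<noteq> 0"
    using pochhammer_pos[of "real k + \<alpha> + 1" k] assms(1) by simp
  have p: "pochhammer (real k + \<alpha> + 1) k = Gamma (2 * real k + \<alpha> + 1) / Gamma (real k + \<alpha> + 1)"
    using assms(1) by (subst pochhammer_Gamma) (auto intro!: nn simp: algebra_simps)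
  have "\<bar>coeff (gegenbauer_poly \<alpha> (Suc n)) 1\<bar> * (4 ^ k * fact k * pochhammer (real k + \<alpha> + 1) k) =
         gegenbauer_K \<alpha> (Suc n) * fact (Suc n)"
    using coeff_gegenbauer_poly_lead[OF assms(1), of "Suc n" 1 k] n by (simp add: add_ac)
  then have "\<bar>coeff (gegenbauer_poly \<alpha> (Suc n)) 1\<bar> / (gegenbauer_K \<alpha> (Suc n) * fact (Suc n)) =
      1 / (4 ^ k * fact k * pochhammer (real k + \<alpha> + 1) k)"
    using pos by (simp add: divide_simps p0 del: fact_Suc)
  also have "(4::real) ^ k = 2 ^ n"
    unfolding n by (simp add: power_mult)
  finally have *: "\<bar>coeff (gegenbauer_poly \<alpha> (Suc n)) 1\<bar> / (gegenbauer_K \<alpha> (Suc n) * fact (Suc n)) =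
     Gamma (real k + \<alpha> + 1) / (2 ^ n * fact k * Gamma (real n + \<alpha> + 1))"
    by (simp add: p n)
  have sq: "real (Suc n) * (real (Suc n) + 2 * \<alpha>) = (real n + 1) * (2 * \<alpha> + real n + 1)"
    by (simp add: algebra_simps)
  have swap: "a / sqrt s / b = a / b * (1 / sqrt s)" for a b s :: real
    by simp
  show ?thesis
    using assms(2) unfolding sq swap * error_factor_neg_def k_def[symmetric] by simp
qed

section \<open>Error bounds at the nodes\<close>

lemma gg_hyps_abs_le:
  assumes "gg_hyps \<alpha> n A Df \<zeta>" and "j \<le> n"
  shows "\<bar>Df (Suc n) (\<zeta> j)\<bar> \<le> A" and "A > 0"
  using assms unfolding gg_hyps_def by auto

lemma trunc_error_bound_nonneg:
  assumes "\<alpha> \<ge> 0" and "gg_hyps \<alpha> n A Df \<zeta>" and "j \<le> n"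
  shows "\<bar>trunc_error \<alpha> n (Df (Suc n) (\<zeta> j)) (gg_node \<alpha> n j)\<bar> \<le>
    A * error_factor_nonneg \<alpha> n * (gg_node \<alpha> n j + 1)"
proof -
  have \<alpha>: "\<alpha> > -1/2" using assms(1) by simp
  show ?thesis
    unfolding gegenbauer_K_eq_Gamma[OF \<alpha>, symmetric]
    using gg_node_zero(1)[OF \<alpha> assms(3)] gg_hyps_abs_le(1)[OF assms(2,3)]
      abs_gegenbauer_le_1[OF assms(1)]
    by (intro abs_trunc_error_le[OF \<alpha>]) auto
qed

lemma trunc_error_bound_odd:
  assumes "\<alpha> > -1/2" and "\<alpha> < 0" and "odd n" and "gg_hyps \<alpha> n A Df \<zeta>" and "j \<le> n"
  shows "\<bar>trunc_error \<alpha> n (Df (Suc n) (\<zeta> j)) (gg_node \<alpha> n j)\<bar> \<le>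
    A * error_factor_neg \<alpha> n * (gg_node \<alpha> n j + 1)"
  unfolding coeff_0_gegenbauer_eq_Gamma[OF assms(1,3), symmetric]
  using gg_node_zero(1)[OF assms(1,5)] gg_hyps_abs_le(1)[OF assms(4,5)]
    abs_gegenbauer_le_even[OF assms(1,2)] assms(3)
  by (intro abs_trunc_error_le[OF assms(1)]) auto

lemma trunc_error_bound_even:
  assumes "\<alpha> > -1/2" and "\<alpha> < 0" and "even n" and "gg_hyps \<alpha> n A Df \<zeta>" and "j \<le> n"
  shows "\<bar>trunc_error \<alpha> n (Df (Suc n) (\<zeta> j)) (gg_node \<alpha> n j)\<bar> <
    A * error_factor_neg \<alpha> n * (gg_node \<alpha> n j + 1)"
proof -
  define M where "M = \<bar>coeff (gegenbauer_poly \<alpha> (Suc n)) 1\<bar> / sqrt (real (Suc n) * (real (Suc n) + 2 * \<alpha>))"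
  have bound: "\<bar>poly (gegenbauer_poly \<alpha> (Suc n)) t\<bar> \<le> M" if "\<bar>t\<bar> \<le> 1" for t
    unfolding M_def using assms(1-3) that by (intro abs_gegenbauer_le_odd) auto
  \<comment> \<open>The bound at t = 1, where the polynomial equals 1, even gives
    \<open>M \<ge> 1\<close>.\<close>
  have "M > 0"
    using bound[of 1] by (simp add: poly_gegenbauer_1[OF assms(1)])
  then show ?thesis
    unfolding coeff_1_gegenbauer_eq_Gamma[OF assms(1,3), symmetric] M_def[symmetric]
    using gg_node_zero[OF assms(1,5)] gg_hyps_abs_le[OF assms(4,5)] bound
    by (intro abs_trunc_error_less[OF assms(1)]) auto
qed

text \<open>In this binomial coefficient a - b + 1 = \<alpha>, so its denominator cancels
  \<open>Gamma \<alpha>\<close>. That value is nonzero because \<alpha> lies strictly between -1/2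
  and 0 and is no pole; at a pole \<open>Gamma\<close> would be 0.\<close>

lemma error_factor_neg_odd:
  assumes "\<alpha> > -1/2" and "\<alpha> < 0" and "odd n"
  shows "error_factor_neg \<alpha> n = 2 powr (- real n - 1) * Gamma \<alpha> / Gamma (real n + \<alpha> + 1) *
    gbinom ((real n - 1) / 2 + \<alpha>) ((real n + 1) / 2)"
proof -
  define k where "k = (n + 1) div 2"
  have "n + 1 = 2 * k" and "k \<ge> 1"
    using assms(3) by (auto simp: k_def elim!: oddE)
  then have rn: "real n = 2 * real k - 1"
    by linarith
  define s where "s = real k + \<alpha>"
  have "s > 0"
    using \<open>k \<ge> 1\<close> assms(1) unfolding s_def by linarith
  have "\<alpha> \<notin> \<int>"
    using assms by (auto elim!: Ints_cases)
  then have \<alpha>: "Gamma \<alpha> \<noteq> 0"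
    using Gamma_eq_zero_iff[of \<alpha>] nonpos_Ints_subset_Ints by blast
  have g: "Gamma (s + 1) = s * Gamma s"
    using \<open>s > 0\<close> by (intro Gamma_plus1) auto
  have b: "gbinom ((real n - 1) / 2 + \<alpha>) ((real n + 1) / 2) = Gamma s / (fact k * Gamma \<alpha>)"
    by (simp add: gbinom_def rn s_def Gamma_fact[symmetric] add_ac diff_divide_distrib)
  have p: "2 powr (- real n - 1) = 1 / (2 ^ n * 2)"
    by (simp add: powr_diff powr_minus_divide powr_realpow)
  have d: "real n + 1 + 2 * \<alpha> = 2 * s"
    by (simp add: rn s_def)
  show ?thesis
    unfolding error_factor_neg_def k_def[symmetric] s_def[symmetric] b p d g
    using assms(3) \<alpha> \<open>s > 0\<close> by simp
qed

text \<open>Now a - b + 1 = \<alpha> + 1, and the binomial denominator cancels the positive factor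
  \<open>Gamma (\<alpha> + 1)\<close>.\<close>

lemma error_factor_neg_even:
  assumes "\<alpha> > -1/2" and "even n"
  shows "error_factor_neg \<alpha> n = 2 powr (- real n) * Gamma (\<alpha> + 1)
    / (sqrt ((real n + 1) * (2 * \<alpha> + real n + 1)) * Gamma (real n + \<alpha> + 1))
    * gbinom (real n / 2 + \<alpha>) (real n / 2)"
proof -
  define k where "k = (n + 1) div 2"
  have n: "n = 2 * k"
    using assms(2) by (auto simp: k_def elim!: evenE)
  have \<alpha>: "Gamma (\<alpha> + 1) > 0"
    using assms(1) by (intro Gamma_real_pos) simp
  have "gbinom (real n / 2 + \<alpha>) (real n / 2) = Gamma (real k + \<alpha> + 1) / (fact k * Gamma (\<alpha> + 1))"
    by (simp add: gbinom_def n Gamma_fact[symmetric] add_ac)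
  moreover have "2 powr (- real n) = 1 / 2 ^ n"
    by (simp add: powr_minus_divide powr_realpow)
  ultimately show ?thesis
    using assms(2) \<alpha> unfolding error_factor_neg_def k_def[symmetric] by simp
qed

section \<open>Asymptotics\<close>

text \<open>Only the existence of the limit matters, so Wallis' product, which identifies it as
  \<open>sqrt (2 * pi)\<close>, is not needed.\<close>

lemma fact_asymptotics:
  obtains C :: real where "C > 0"
    and "(\<lambda>n. fact n / (real n powr (real n + 1/2) * exp (- real n))) \<longlonglongrightarrow> C"
proof -
  define u :: "nat \<Rightarrow> real" where "u = (\<lambda>n. ln (fact n) - (real n + 1/2) * ln (real n) + real n)"
  \<comment> \<open>The identity is purely algebraic in the logarithms, so it also holds at
    \<open>n = 0\<close>, whatever the value of \<open>ln 0\<close>.\<close>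
  have "u (Suc n) - u n = 1 - (real n + 1/2) * (ln (real n + 1) - ln (real n))" for n
  proof -
    have "fact (Suc n) = (real n + 1) * fact n"
      by simp
    then have "ln (fact (Suc n)) = ln (real n + 1) + ln (fact n :: real)"
      by (simp add: ln_mult del: fact_Suc)
    then show ?thesis
      by (simp add: u_def algebra_simps del: fact_Suc)
  qed
  \<comment> \<open>In (n + 1/2) ln (1 + 1/n) the term of order 1/n cancels, so the increments are
    O(1/n^2) and telescoping gives convergence.\<close>
  moreover have "summable (\<lambda>n. 1 - (real n + 1/2) * (ln (real n + 1) - ln (real n)))"
  proof (rule summable_comparison_test_bigo)
    show "summable (\<lambda>n. norm (inverse (real n ^ 2)))"
      using inverse_power_summable[of 2, where 'a = real] by simp
    show "(\<lambda>n. 1 - (real n + 1/2) * (ln (real n + 1) - ln (real n))) \<in> O(\<lambda>n. inverse (real n ^ 2))"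
      by real_asymp
  qed
  ultimately have "summable (\<lambda>n. u (Suc n) - u n)"
    by simp
  then have "(\<lambda>n. \<Sum>i<n. u (Suc i) - u i) \<longlonglongrightarrow> (\<Sum>n. u (Suc n) - u n)"
    by (rule summable_LIMSEQ)
  then have "(\<lambda>n. (u n - u 0) + u 0) \<longlonglongrightarrow> (\<Sum>n. u (Suc n) - u n) + u 0"
    unfolding sum_lessThan_telescope by (intro tendsto_intros)
  then have "(\<lambda>n. exp (u n)) \<longlonglongrightarrow> exp ((\<Sum>n. u (Suc n) - u n) + u 0)"
    by (intro tendsto_intros) simp
  moreover have "\<forall>\<^sub>F n in sequentially.
      exp (u n) = fact n / (real n powr (real n + 1/2) * exp (- real n))"
    using eventually_gt_at_top[of 0]
  proof eventually_elim
    case (elim n)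
    have "exp (ln f - t + x) = f / (exp t * exp (- x))" if "f > 0" for f t x :: real
      using that by (simp add: exp_add exp_diff exp_minus divide_simps)
    moreover have "real n powr (real n + 1/2) = exp ((real n + 1/2) * ln (real n))"
      using elim by (simp add: powr_def)
    ultimately show ?case
      by (simp only: u_def fact_gt_zero)
  qed
  ultimately have "(\<lambda>n. fact n / (real n powr (real n + 1/2) * exp (- real n)))
      \<longlonglongrightarrow> exp ((\<Sum>n. u (Suc n) - u n) + u 0)"
    by (simp add: tendsto_cong)
  then show ?thesis
    by (rule that[rotated]) simp
qed

text \<open>Euler's limit for Gamma (a + 1), read backwards: its Pochhammer denominator is Gamma (n
  + a + 1) / Gamma (a + 1).\<close>

lemma Gamma_div_fact_asymptotics:
  fixes a :: real
  assumes "a > -1"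
  shows "(\<lambda>n. Gamma (real n + a + 1) / (fact n * real n powr a)) \<longlonglongrightarrow> 1"
proof -
  have "Gamma (a + 1) > 0"
    using assms by (intro Gamma_real_pos) simp
  have "a + 1 \<notin> \<int>\<^sub>\<le>\<^sub>0"
    using assms by auto
  have "(\<lambda>n. Gamma (a + 1) / Gamma_series' (a + 1) n) \<longlonglongrightarrow> Gamma (a + 1) / Gamma (a + 1)"
    using \<open>Gamma (a + 1) > 0\<close> by (intro tendsto_intros Gamma_series'_LIMSEQ) simp
  moreover have "\<forall>\<^sub>F n in sequentially.
      Gamma (a + 1) / Gamma_series' (a + 1) n = Gamma (real n + a + 1) / (fact n * real n powr a)"
    using eventually_gt_at_top[of 0]
  proof eventually_elim
    case (elim n)
    have "fact n = real n * fact (n - 1)"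
      using elim by (simp add: fact_reduce)
    moreover have "exp ((a + 1) * ln (real n)) = real n powr a * real n"
      using elim by (simp add: powr_def distrib_right exp_add)
    moreover have "pochhammer (a + 1) n = Gamma (real n + a + 1) / Gamma (a + 1)"
      using \<open>a + 1 \<notin> \<int>\<^sub>\<le>\<^sub>0\<close> by (simp add: pochhammer_Gamma add_ac)
    ultimately show ?case
      using \<open>Gamma (a + 1) > 0\<close> by (simp add: Gamma_series'_def mult_ac)
  qed
  ultimately show ?thesis
    using \<open>Gamma (a + 1) > 0\<close> by (simp add: tendsto_cong)
qed

text \<open>The quotient splits into factors with known limits: the ratio of Gammas grows like
  n^\<alpha>, the factor n + 1 of (n + 1)! like n, and n! as in
  \<open>fact_asymptotics\<close>.\<close>

lemma error_factor_nonneg_asymptotics: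
  assumes "\<alpha> \<ge> 0"
  shows "\<exists>D>0. error_factor_nonneg \<alpha> \<sim>[at_top]
    (\<lambda>n. D * ((exp 1 / 2) ^ n * real n powr (\<alpha> - real n - 3/2)))"
proof -
  obtain C :: real where C: "C > 0"
    "(\<lambda>n. fact n / (real n powr (real n + 1/2) * exp (- real n))) \<longlonglongrightarrow> C"
    by (rule fact_asymptotics)
  define S where "S = (\<lambda>n. fact n / (real n powr (real n + 1/2) * exp (- real n)))"
  define R where "R = (\<lambda>a n. Gamma (real n + a + 1) / (fact n * real n powr a))"
  define c where "c = Gamma (\<alpha> + 1) / Gamma (2 * \<alpha> + 1)"
  have "c > 0"
    using assms by (simp add: c_def Gamma_real_pos)
  have R: "R \<alpha> \<longlonglongrightarrow> 1" "R (2 * \<alpha>) \<longlonglongrightarrow> 1"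
    unfolding R_def using assms by (intro Gamma_div_fact_asymptotics; simp)+
  have "(\<lambda>n. real n / (real n + 1)) \<longlonglongrightarrow> 1"
    by real_asymp
  then have "(\<lambda>n. c * (R (2 * \<alpha>) n / R \<alpha> n) * (real n / (real n + 1)) * (1 / S n))
      \<longlonglongrightarrow> c * (1 / 1) * 1 * (1 / C)"
    using R C by (intro tendsto_intros) (auto simp: S_def)
  moreover have "\<forall>\<^sub>F n in sequentially.
      c * (R (2 * \<alpha>) n / R \<alpha> n) * (real n / (real n + 1)) * (1 / S n) =
      error_factor_nonneg \<alpha> n / ((exp 1 / 2) ^ n * real n powr (\<alpha> - real n - 3/2))"
    using eventually_gt_at_top[of 0]
  proof eventually_elim
    case (elim n)
    define p q where "p = real n powr \<alpha>" and "q = real n powr (real n + 1/2)"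
    have e1: "real n powr (2 * \<alpha>) = p * p"
      using elim by (simp add: p_def flip: powr_add)
    have e2: "real n powr (\<alpha> - real n - 3/2) = p / (q * real n)"
    proof -
      have "real n powr (\<alpha> - real n - 3/2) = real n powr (\<alpha> - ((real n + 1/2) + 1))"
        by (simp add: algebra_simps)
      then show ?thesis
        using elim by (simp only: powr_diff powr_add p_def q_def) simp
    qed
    have e3: "(exp 1 / 2 :: real) ^ n = 1 / (exp (- real n) * 2 ^ n)"
      by (simp add: power_divide exp_minus field_simps flip: exp_of_nat_mult)
    have e4: "fact (Suc n) = (real n + 1) * fact n"
      by simp
    have pos: "p > 0" "q > 0" "exp (- real n) > 0" "Gamma (real n + \<alpha> + 1) > 0" "real n > 0"
      "(fact n :: real) > 0" "(2 :: real) ^ n > 0"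
      using elim assms by (simp_all add: p_def q_def Gamma_real_pos)
    \<comment> \<open>An identity of rational functions, stated for independent variables that hide
      how Gammas, factorials and powers depend on \<open>n\<close>.\<close>
    have "a / b * (g / (f * (p * p)) / (g' / (f * p))) * (N / (N + 1)) * (1 / (f / (q * x))) =
        a * g / (t * b * ((N + 1) * f) * g') / (1 / (x * t) * (p / (q * N)))"
      if "p > 0" "q > 0" "x > 0" "g' > 0" "N > 0" "f > 0" "t > 0" for a b g g' f p q x t N :: real
    proof -
      have "N + 1 > 0" using that by simp
      then show ?thesis using that by (simp add: divide_simps)
    qed
    from this[OF pos] show ?case
      unfolding R_def S_def c_def error_factor_nonneg_def e4 e1 e2 e3
        p_def[symmetric] q_def[symmetric] .
  qed
  ultimately have "(\<lambda>n. error_factor_nonneg \<alpha> n / ((exp 1 / 2) ^ n * real n powr (\<alpha> - real n - 3/2)))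
      \<longlonglongrightarrow> c / C"
    by (simp add: tendsto_cong)
  moreover have "c / C > 0"
    using \<open>c > 0\<close> C(1) by simp
  ultimately show ?thesis
    by (intro exI[of _ "c / C"] conjI asymp_equivI'_const) auto
qed

text \<open>The ratio of Gammas at k, about n/2, contributes k^\<alpha> and the one at n contributes
  n^(-\<alpha>). Together they tend to (1/2)^\<alpha>, so \<alpha> disappears from the exponent of
  n.\<close>

lemma error_factor_neg_asymptotics:
  assumes "\<alpha> > -1/2"
  shows "\<exists>D>0. error_factor_neg \<alpha> \<sim>[at_top]
    (\<lambda>n. D * ((exp 1 / 2) ^ n * real n powr (- real n - 3/2)))"
proof -
  obtain C :: real where C: "C > 0"
    "(\<lambda>n. fact n / (real n powr (real n + 1/2) * exp (- real n))) \<longlonglongrightarrow> C"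
    by (rule fact_asymptotics)
  define S where "S = (\<lambda>n. fact n / (real n powr (real n + 1/2) * exp (- real n)))"
  define R where "R = (\<lambda>n. Gamma (real n + \<alpha> + 1) / (fact n * real n powr \<alpha>))"
  define s where "s = (\<lambda>n. if even n then 1 / sqrt ((real n + 1) * (2 * \<alpha> + real n + 1))
     else 1 / (real n + 1 + 2 * \<alpha>))"
  define k where "k = (\<lambda>n::nat. (n + 1) div 2)"
  have R: "R \<longlonglongrightarrow> 1"
    unfolding R_def using assms by (intro Gamma_div_fact_asymptotics) simp
  have k_top: "filterlim k at_top at_top"
    unfolding filterlim_at_top
  proof
    fix Z :: nat
    show "\<forall>\<^sub>F n in at_top. Z \<le> k n"
      using eventually_ge_at_top[of "2 * Z"] by eventually_elim (simp add: k_def)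
  qed
  have Rk: "(\<lambda>n. R (k n)) \<longlonglongrightarrow> 1"
    by (rule filterlim_compose[OF R k_top])
  have kn: "(\<lambda>n. real (k n) / real n) \<longlonglongrightarrow> 1/2"
  proof (rule tendsto_sandwich)
    show "\<forall>\<^sub>F n in sequentially. 1/2 \<le> real (k n) / real n"
      using eventually_gt_at_top[of 0] by eventually_elim (simp add: k_def field_simps)
    show "\<forall>\<^sub>F n in sequentially. real (k n) / real n \<le> ((real n + 1) / 2) / real n"
      by (intro always_eventually allI divide_right_mono) (simp_all add: k_def field_simps)
    show "(\<lambda>n. ((real n + 1) / 2) / real n) \<longlonglongrightarrow> 1/2"
      by real_asymp
  qed simp
  \<comment> \<open>Both parity branches converge to 1 along all of \<open>n\<close>, hence also
    along their own residue class.\<close>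
  have sn: "(\<lambda>n. real n * s n) \<longlonglongrightarrow> 1"
  proof -
    have "(\<lambda>n. real n * (1 / sqrt ((real n + 1) * (2 * \<alpha> + real n + 1)))) \<longlonglongrightarrow> 1"
      "(\<lambda>n. real n * (1 / (real n + 1 + 2 * \<alpha>))) \<longlonglongrightarrow> 1"
      by real_asymp+
    then have "(\<lambda>n. if even n then real n * (1 / sqrt ((real n + 1) * (2 * \<alpha> + real n + 1)))
       else real n * (1 / (real n + 1 + 2 * \<alpha>))) \<longlonglongrightarrow> 1"
      by (intro filterlim_If) (erule tendsto_mono[OF inf_le1])+
    then show ?thesis
      by (simp add: s_def if_distrib cong: if_cong)
  qed
  have "(\<lambda>n. R (k n) / R n * (real (k n) / real n) powr \<alpha> * (real n * s n) * (1 / S n))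
      \<longlonglongrightarrow> 1 / 1 * (1/2) powr \<alpha> * 1 * (1 / C)"
    using C by (intro tendsto_mult tendsto_divide[OF Rk R] tendsto_powr[OF kn] sn tendsto_divide)
      (auto simp: S_def)
  moreover have "\<forall>\<^sub>F n in sequentially.
      R (k n) / R n * (real (k n) / real n) powr \<alpha> * (real n * s n) * (1 / S n) =
      error_factor_neg \<alpha> n / ((exp 1 / 2) ^ n * real n powr (- real n - 3/2))"
    using eventually_gt_at_top[of 0]
  proof eventually_elim
    case (elim n)
    define p p' q where "p = real n powr \<alpha>" and "p' = real (k n) powr \<alpha>"
      and "q = real n powr (real n + 1/2)"
    have "k n > 0"
      using elim by (simp add: k_def)
    have e1: "(real (k n) / real n) powr \<alpha> = p' / p"
      by (simp add: p_def p'_def powr_divide)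
    have e2: "real n powr (- real n - 3/2) = 1 / (q * real n)"
    proof -
      have "real n powr (- real n - 3/2) = real n powr (- ((real n + 1/2) + 1))"
        by (simp add: algebra_simps)
      then show ?thesis
        using elim by (simp only: powr_minus_divide powr_add q_def) simp
    qed
    have e3: "(exp 1 / 2 :: real) ^ n = 1 / (exp (- real n) * 2 ^ n)"
      by (simp add: power_divide exp_minus field_simps flip: exp_of_nat_mult)
    have pos: "p > 0" "p' > 0" "q > 0" "exp (- real n) > 0" "Gamma (real n + \<alpha> + 1) > 0"
      "real n > 0" "(fact n :: real) > 0" "(fact (k n) :: real) > 0" "(2 :: real) ^ n > 0"
      using elim assms \<open>k n > 0\<close> by (simp_all add: p_def p'_def q_def Gamma_real_pos)
    have e4: "error_factor_neg \<alpha> n =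
        Gamma (real (k n) + \<alpha> + 1) / (2 ^ n * fact (k n) * Gamma (real n + \<alpha> + 1)) * s n"
      by (simp add: error_factor_neg_def k_def s_def)
    have "g / (f' * p') / (g' / (f * p)) * (p' / p) * (N * z) * (1 / (f / (q * x))) =
        g / (t * f' * g') * z / (1 / (x * t) * (1 / (q * N)))"
      if "p > 0" "p' > 0" "q > 0" "x > 0" "g' > 0" "N > 0" "f > 0" "f' > 0" "t > 0"
      for g g' f f' p p' q x t N z :: real
      using that by (simp add: divide_simps)
    from this[OF pos] show ?case
      unfolding R_def S_def e4 e1 e2 e3 p_def[symmetric] p'_def[symmetric] q_def[symmetric] .
  qed
  ultimately have "(\<lambda>n. error_factor_neg \<alpha> n / ((exp 1 / 2) ^ n * real n powr (- real n - 3/2)))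
      \<longlonglongrightarrow> (1/2) powr \<alpha> / C"
    by (simp add: tendsto_cong)
  moreover have "(1/2) powr \<alpha> / C > 0"
    using C(1) by simp
  ultimately show ?thesis
    by (intro exI[of _ "(1/2) powr \<alpha> / C"] conjI asymp_equivI'_const) auto
qed

section \<open>Explicit bounds and asymptotics for both signs of \<alpha>\<close>

theorem theorem4:
  fixes \<alpha> :: real
  assumes "\<alpha> > -1/2"
  shows
   "(\<forall>n A Df \<zeta>. gg_hyps \<alpha> n A Df \<zeta> \<longrightarrow>
      (\<forall>j\<le>n.
        (\<alpha> \<ge> 0 \<longrightarrow>
           \<bar>trunc_error \<alpha> n (Df (Suc n) (\<zeta> j)) (gg_node \<alpha> n j)\<bar>
             \<le> A * 2 powr (- real n) * (gg_node \<alpha> n j + 1) * Gamma (\<alpha> + 1) * Gamma (real n + 2 * \<alpha> + 1)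
                / (Gamma (2 * \<alpha> + 1) * Gamma (real n + 2) * Gamma (real n + \<alpha> + 1))) \<and>
        (odd n \<and> \<alpha> < 0 \<longrightarrow>
           \<bar>trunc_error \<alpha> n (Df (Suc n) (\<zeta> j)) (gg_node \<alpha> n j)\<bar>
             \<le> A * 2 powr (- real n - 1) * (gg_node \<alpha> n j + 1) * Gamma \<alpha> / Gamma (real n + \<alpha> + 1)
                * gbinom ((real n - 1) / 2 + \<alpha>) ((real n + 1) / 2)) \<and>
        (even n \<and> \<alpha> < 0 \<longrightarrow>
           \<bar>trunc_error \<alpha> n (Df (Suc n) (\<zeta> j)) (gg_node \<alpha> n j)\<bar>
             < A * 2 powr (- real n) * (gg_node \<alpha> n j + 1) * Gamma (\<alpha> + 1)
                / (sqrt ((real n + 1) * (2 * \<alpha> + real n + 1)) * Gamma (real n + \<alpha> + 1))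
                * gbinom (real n / 2 + \<alpha>) (real n / 2)))) \<and>
    (\<exists>D1 D2. D1 > 0 \<and> D2 > 0 \<and>
      (\<alpha> \<ge> 0 \<longrightarrow>
         (\<exists>h :: nat \<Rightarrow> real.
            h \<sim>[at_top] (\<lambda>n. D1 * (exp 1 / 2) ^ n * real n powr (\<alpha> - real n - 3/2)) \<and>
            (\<forall>n A Df \<zeta> j. gg_hyps \<alpha> n A Df \<zeta> \<and> j \<le> n \<longrightarrow>
               \<bar>trunc_error \<alpha> n (Df (Suc n) (\<zeta> j)) (gg_node \<alpha> n j)\<bar> \<le> A * h n * (gg_node \<alpha> n j + 1)))) \<and>
      (\<alpha> < 0 \<longrightarrow>
         (\<exists>h :: nat \<Rightarrow> real.
            h \<sim>[at_top] (\<lambda>n. D1 * D2 * (exp 1 / 2) ^ n * real n powr (- real n - 3/2)) \<and>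
            (\<forall>n A Df \<zeta> j. gg_hyps \<alpha> n A Df \<zeta> \<and> j \<le> n \<longrightarrow>
               \<bar>trunc_error \<alpha> n (Df (Suc n) (\<zeta> j)) (gg_node \<alpha> n j)\<bar> \<le> A * h n * (gg_node \<alpha> n j + 1)))))"
    (is "?bounds \<and> (\<exists>D1 D2. ?asymp D1 D2)")
proof
  have nonneg: "error_factor_nonneg \<alpha> n = 2 powr (- real n) * Gamma (\<alpha> + 1) * Gamma (real n + 2 * \<alpha> + 1)
                / (Gamma (2 * \<alpha> + 1) * Gamma (real n + 2) * Gamma (real n + \<alpha> + 1))" for n
    using Gamma_fact[of "Suc n", where 'a = real]
    by (simp add: error_factor_nonneg_def powr_minus_divide powr_realpow add_ac mult_ac del: fact_Suc)
  show ?bounds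
  proof (intro allI impI conjI)
    fix n A Df \<zeta> j
    assume hyps: "gg_hyps \<alpha> n A Df \<zeta>" and j: "j \<le> n"
    let ?E = "\<bar>trunc_error \<alpha> n (Df (Suc n) (\<zeta> j)) (gg_node \<alpha> n j)\<bar>"
    show "?E \<le> A * 2 powr (- real n) * (gg_node \<alpha> n j + 1) * Gamma (\<alpha> + 1) * Gamma (real n + 2 * \<alpha> + 1)
                / (Gamma (2 * \<alpha> + 1) * Gamma (real n + 2) * Gamma (real n + \<alpha> + 1))" if "\<alpha> \<ge> 0"
      using trunc_error_bound_nonneg[OF that hyps j] by (simp add: nonneg mult_ac)
    show "?E \<le> A * 2 powr (- real n - 1) * (gg_node \<alpha> n j + 1) * Gamma \<alpha> / Gamma (real n + \<alpha> + 1)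
                * gbinom ((real n - 1) / 2 + \<alpha>) ((real n + 1) / 2)" if "odd n \<and> \<alpha> < 0"
      using trunc_error_bound_odd[OF assms _ _ hyps j] that error_factor_neg_odd[OF assms, of n]
      by (simp add: mult_ac)
    show "?E < A * 2 powr (- real n) * (gg_node \<alpha> n j + 1) * Gamma (\<alpha> + 1)
                / (sqrt ((real n + 1) * (2 * \<alpha> + real n + 1)) * Gamma (real n + \<alpha> + 1))
                * gbinom (real n / 2 + \<alpha>) (real n / 2)" if "even n \<and> \<alpha> < 0"
      using trunc_error_bound_even[OF assms _ _ hyps j] that error_factor_neg_even[OF assms, of n]
      by (simp add: mult_ac)
  qed
  show "\<exists>D1 D2. ?asymp D1 D2"
  proof (cases "\<alpha> \<ge> 0")
    case True
    then obtain D where D: "D > 0" "error_factor_nonneg \<alpha> \<sim>[at_top]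
        (\<lambda>n. D * ((exp 1 / 2) ^ n * real n powr (\<alpha> - real n - 3/2)))"
      using error_factor_nonneg_asymptotics by blast
    show ?thesis
    proof (rule exI[of _ D], rule exI[of _ 1], intro conjI impI)
      show "\<exists>h. h \<sim>[at_top] (\<lambda>n. D * (exp 1 / 2) ^ n * real n powr (\<alpha> - real n - 3/2)) \<and>
          (\<forall>n A Df \<zeta> j. gg_hyps \<alpha> n A Df \<zeta> \<and> j \<le> n \<longrightarrow>
            \<bar>trunc_error \<alpha> n (Df (Suc n) (\<zeta> j)) (gg_node \<alpha> n j)\<bar> \<le> A * h n * (gg_node \<alpha> n j + 1))"
      \<comment> \<open>With the explicit bound itself as \<open>h\<close>, the inequality holds for
        every \<open>n\<close>, uniformly in \<open>j\<close>, and only \<open>h\<close> has to be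
        compared asymptotically.\<close>
      proof (intro exI[of _ "error_factor_nonneg \<alpha>"] conjI)
        show "error_factor_nonneg \<alpha> \<sim>[at_top]
            (\<lambda>n. D * (exp 1 / 2) ^ n * real n powr (\<alpha> - real n - 3/2))"
          using D(2) by (simp only: mult.assoc)
      qed (use trunc_error_bound_nonneg[OF True] in blast)
    qed (use D(1) True in auto)
  next
    case False
    then have neg: "\<alpha> < 0" by simp
    obtain D where D: "D > 0" "error_factor_neg \<alpha> \<sim>[at_top]
        (\<lambda>n. D * ((exp 1 / 2) ^ n * real n powr (- real n - 3/2)))"
      using error_factor_neg_asymptotics[OF assms] by blast
    have le: "\<bar>trunc_error \<alpha> n (Df (Suc n) (\<zeta> j)) (gg_node \<alpha> n j)\<bar> \<le>
        A * error_factor_neg \<alpha> n * (gg_node \<alpha> n j + 1)"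
      if "gg_hyps \<alpha> n A Df \<zeta>" "j \<le> n" for n A Df \<zeta> j
      using trunc_error_bound_odd[OF assms neg _ that] trunc_error_bound_even[OF assms neg _ that]
      by (cases "even n") (auto intro: less_imp_le)
    show ?thesis
    \<comment> \<open>The limit constant must equal \<open>D1 * D2\<close>, which
      \<open>D1 = D\<close> and \<open>D2 = 1\<close> achieve.\<close>
    proof (rule exI[of _ D], rule exI[of _ 1], intro conjI impI)
      show "\<exists>h. h \<sim>[at_top] (\<lambda>n. D * 1 * (exp 1 / 2) ^ n * real n powr (- real n - 3/2)) \<and>
          (\<forall>n A Df \<zeta> j. gg_hyps \<alpha> n A Df \<zeta> \<and> j \<le> n \<longrightarrow>
            \<bar>trunc_error \<alpha> n (Df (Suc n) (\<zeta> j)) (gg_node \<alpha> n j)\<bar> \<le> A * h n * (gg_node \<alpha> n j + 1))"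
      proof (intro exI[of _ "error_factor_neg \<alpha>"] conjI)
        show "error_factor_neg \<alpha> \<sim>[at_top]
            (\<lambda>n. D * 1 * (exp 1 / 2) ^ n * real n powr (- real n - 3/2))"
          using D(2) by (simp only: mult.assoc mult_1_left)
      qed (use le in blast)
    qed (use D(1) neg in auto)
  qed
qed

end
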